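(* Let $\rho,\sigma$ be faithful states on $\mathcal{M}$, and let $\mathcal{N}$ be a von Neumann subalgebra of $\mathcal{M}$. Let $\mathcal{C}$ be the fixed-point algebra of the Accardi-Cecchini coarse graining operator $\mathcal{A}_\rho$ for $\mathcal{N}$. Let $\mathcal{E}_{\mathcal{C},\rho}$ be the conditional expectation given $\mathcal{C}$ under $\rho$. Define $\rho_{\mathcal{C}} = \mathcal{E}_{\mathcal{C},\rho}^\dagger(\rho)$ and $\sigma_{\mathcal{C}} = \mathcal{E}_{\mathcal{C},\rho}^\dagger(\sigma)$. Then $$S(\rho||\sigma) = S(\rho_{\mathcal{N}}||\sigma_{\mathcal{N}}) \quad\Longleftrightarrow\quad S(\rho||\sigma) = S(\rho_{\mathcal{C}}||\sigma_{\mathcal{C}}) .$$ In particular, if $\mathcal{C}$ is spanned by $\mathbf{1}$, then $S(\rho||\sigma) = S(\rho_{\mathcal{N}}||\sigma_{\mathcal{N}})$ if and only if $\rho=\sigma$.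
   Context: $\mathcal{M}$ is a finite dimensional von Neumann algebra, regarded as a unital $*$-subalgebra of $M_n(\mathbb{C})$; $\mathrm{Tr}$ is the trace on $M_n(\mathbb{C})$, $\mathbf{1}$ the identity. A von Neumann subalgebra is a $*$-subalgebra containing $\mathbf{1}$. States on $\mathcal{M}$ are identified with density matrices $\rho\in\mathcal{M}$ ($\rho\ge0$, $\mathrm{Tr}[\rho]=1$) via $\rho(X)=\mathrm{Tr}[\rho X]$; faithful means $\rho$ invertible. $\mathcal{E}_\tau:\mathcal{M}\to\mathcal{N}$ is the orthogonal projection of $\mathcal{M}$ onto $\mathcal{N}$ for $\langle X,Y\rangle_{HS}=\mathrm{Tr}[X^*Y]$; for a state $\sigma$, $\sigma_{\mathcal{N}}=\mathcal{E}_\tau(\sigma)$. The relative entropy is $S(\rho||\sigma)=\mathrm{Tr}[\rho(\log\rho-\log\sigma)]$. The Accardi-Cecchini coarse graining operator $\mathcal{A}_\rho:\mathcal{M}\to\mathcal{N}$ is $\mathcal{A}_\rho(X)=\rho_{\mathcal{N}}^{-1/2}\mathcal{E}_\tau(\rho^{1/2}X\rho^{1/2})\rho_{\mathcal{N}}^{-1/2}$. Its fixed-point set $\mathcal{C}=\{X\in\mathcal{M}:\mathcal{A}_\rho(X)=X\}$ is a von Neumann subalgebra of $\mathcal{N}$. $\mathcal{E}_{\mathcal{C},\rho}$, the conditional expectation given $\mathcal{C}$ under $\rho$, is the orthogonal projection of $\mathcal{M}$ onto $\mathcal{C}$ in the GNS inner product $\langle X,Y\rangle_{GNS,\rho}=\mathrm{Tr}[\rho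 X^*Y]$; it is regarded as a map $\mathcal{M}\to\mathcal{M}$, and it is unital and completely positive. $\mathcal{E}_{\mathcal{C},\rho}^\dagger:\mathcal{M}\to\mathcal{M}$ is its adjoint with respect to $\langle\cdot,\cdot\rangle_{HS}$, so that the state $\mathcal{E}_{\mathcal{C},\rho}^\dagger(\sigma)$ satisfies $\mathrm{Tr}[\mathcal{E}_{\mathcal{C},\rho}^\dagger(\sigma)X]=\sigma(\mathcal{E}_{\mathcal{C},\rho}(X))$ for all $X\in\mathcal{M}$. *)

theory Defs
  imports "HOL-Analysis.Analysis"
begin

text \<open>
  Elements of the matrix algebra $M_n(C)$ are of type \<open>complex^'n^'n\<close>.  For a complex number
  \<open>c\<close>, the library matrix \<open>mat c\<close> is the scalar multiple \<open>c\<close> of the identity, so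
  \<open>mat c ** X\<close> is complex scalar multiplication; the operation \<open>*\<close> on this type is
  componentwise and is not used.
\<close>

definition adj :: "complex^'n^'n \<Rightarrow> complex^'n^'n" where
  "adj A = (\<chi> i j. cnj (A $ j $ i))"

definition unitary :: "complex^'n^'n \<Rightarrow> bool" where
  "unitary U \<longleftrightarrow> adj U ** U = mat 1 \<and> U ** adj U = mat 1"

definition diag :: "('n \<Rightarrow> real) \<Rightarrow> complex^'n^'n" where
  "diag d = (\<chi> i j. if i = j then complex_of_real (d i) else 0)"

definition positive_mat :: "complex^'n^'n \<Rightarrow> bool" where
  "positive_mat A \<longleftrightarrow>
     adj A = A \<and> (\<forall>x. 0 \<le> Re (\<Sum>i\<in>UNIV. cnj (x $ i) * (A *v x) $ i))"

text \<open>
  Functional calculus for self-adjoint matrices. The value does not depend on the chosen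
  diagonalization, see \<open>fun_calc_diagonalized\<close> below; it is meaningless if the matrix is
  not self-adjoint.
\<close>

definition fun_calc :: "(real \<Rightarrow> real) \<Rightarrow> complex^'n^'n \<Rightarrow> complex^'n^'n" where
  "fun_calc f A =
     (THE B. \<exists>U d. unitary U \<and> A = U ** diag d ** adj U \<and> B = U ** diag (f \<circ> d) ** adj U)"

definition mat_log :: "complex^'n^'n \<Rightarrow> complex^'n^'n" where
  "mat_log = fun_calc ln"

definition mat_powr :: "complex^'n^'n \<Rightarrow> real \<Rightarrow> complex^'n^'n" where
  "mat_powr A a = fun_calc (\<lambda>t. t powr a) A"

lemma matrix_mult_diag_right: "(A ** diag d) $ i $ j = A $ i $ j * complex_of_real (d j)"
  by (simp add: matrix_matrix_mult_def diag_def if_distrib cong: if_cong)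

lemma matrix_mult_diag_left: "(diag d ** A) $ i $ j = complex_of_real (d i) * A $ i $ j"
  by (simp add: matrix_matrix_mult_def diag_def if_distrib[of "\<lambda>x. x * _"] cong: if_cong)

lemma fun_calc_diagonalized:
  assumes U: "unitary U"
  shows "fun_calc f (U ** diag d ** adj U) = U ** diag (f \<circ> d) ** adj U"
  unfolding fun_calc_def
proof (rule the_equality)
  show "\<exists>V e. unitary V \<and> U ** diag d ** adj U = V ** diag e ** adj V \<and>
          U ** diag (f \<circ> d) ** adj U = V ** diag (f \<circ> e) ** adj V"
    using U by blast
next
  fix B
  assume "\<exists>V e. unitary V \<and> U ** diag d ** adj U = V ** diag e ** adj V \<and>
            B = V ** diag (f \<circ> e) ** adj V"
  then obtain V e where V: "unitary V" and eq: "U ** diag d ** adj U = V ** diag e ** adj V"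
    and B: "B = V ** diag (f \<circ> e) ** adj V" by blast
  define W where "W = adj V ** U"
  have conj_eq: "adj V ** (U ** X ** adj U) ** U = W ** X" for X
    using U unfolding W_def unitary_def by (metis matrix_mul_assoc matrix_mul_rid)
  have conj_eq': "adj V ** (V ** X ** adj V) ** U = X ** W" for X
    using V unfolding W_def unitary_def by (metis matrix_mul_assoc matrix_mul_lid)
  have "W ** diag d = diag e ** W"
    using conj_eq[of "diag d"] conj_eq'[of "diag e"] eq by simp
  then have "W $ i $ j * complex_of_real (d j) = complex_of_real (e i) * W $ i $ j" for i j
    by (metis matrix_mult_diag_left matrix_mult_diag_right)
  then have "W $ i $ j = 0 \<or> d j = e i" for i j
    by (metis mult.commute mult_left_cancel of_real_eq_iff)
  then have "(W ** diag (f \<circ> d)) $ i $ j = (diag (f \<circ> e) ** W) $ i $ j" for i j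
    by (simp add: matrix_mult_diag_left matrix_mult_diag_right)
       (metis mult.commute mult_zero_left)
  then have "W ** diag (f \<circ> d) = diag (f \<circ> e) ** W"
    by (simp add: vec_eq_iff)
  then have "V ** (W ** diag (f \<circ> d)) ** adj U = V ** (diag (f \<circ> e) ** W) ** adj U"
    by simp
  then show "B = U ** diag (f \<circ> d) ** adj U"
    using U V unfolding B W_def unitary_def
    by (metis matrix_mul_assoc matrix_mul_lid matrix_mul_rid)
qed

definition vn_algebra :: "(complex^'n^'n) set \<Rightarrow> bool" where
  "vn_algebra M \<longleftrightarrow>
     mat 1 \<in> M \<and>
     (\<forall>X\<in>M. \<forall>Y\<in>M. X + Y \<in> M \<and> X ** Y \<in> M) \<and>
     (\<forall>c. \<forall>X\<in>M. mat c ** X \<in> M) \<and>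
     (\<forall>X\<in>M. adj X \<in> M)"

definition faithful_state :: "(complex^'n^'n) set \<Rightarrow> complex^'n^'n \<Rightarrow> bool" where
  "faithful_state M \<rho> \<longleftrightarrow> \<rho> \<in> M \<and> positive_mat \<rho> \<and> trace \<rho> = 1 \<and> invertible \<rho>"

definition hs_inner :: "complex^'n^'n \<Rightarrow> complex^'n^'n \<Rightarrow> complex" where
  "hs_inner X Y = trace (adj X ** Y)"

definition gns_inner :: "complex^'n^'n \<Rightarrow> complex^'n^'n \<Rightarrow> complex^'n^'n \<Rightarrow> complex" where
  "gns_inner \<rho> X Y = trace (\<rho> ** adj X ** Y)"

definition orth_proj ::
  "(complex^'n^'n \<Rightarrow> complex^'n^'n \<Rightarrow> complex) \<Rightarrow> (complex^'n^'n) set \<Rightarrow>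
    complex^'n^'n \<Rightarrow> complex^'n^'n" where
  "orth_proj ip V X = (THE Y. Y \<in> V \<and> (\<forall>Z\<in>V. ip Z (X - Y) = 0))"

definition trace_expectation :: "(complex^'n^'n) set \<Rightarrow> complex^'n^'n \<Rightarrow> complex^'n^'n" where
  "trace_expectation N = orth_proj hs_inner N"

definition cond_expectation ::
  "(complex^'n^'n) set \<Rightarrow> complex^'n^'n \<Rightarrow> complex^'n^'n \<Rightarrow> complex^'n^'n" where
  "cond_expectation C \<rho> = orth_proj (gns_inner \<rho>) C"

definition hs_adjoint ::
  "(complex^'n^'n) set \<Rightarrow> (complex^'n^'n \<Rightarrow> complex^'n^'n) \<Rightarrow> complex^'n^'n \<Rightarrow> complex^'n^'n"
  where
  "hs_adjoint M \<Phi> Y = (THE W. W \<in> M \<and> (\<forall>X\<in>M. hs_inner W X = hs_inner Y (\<Phi> X)))"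

definition accardi_cecchini ::
  "(complex^'n^'n) set \<Rightarrow> complex^'n^'n \<Rightarrow> complex^'n^'n \<Rightarrow> complex^'n^'n" where
  "accardi_cecchini N \<rho> X =
     (let R = mat_powr (trace_expectation N \<rho>) (- 1 / 2)
      in R ** trace_expectation N (mat_powr \<rho> (1 / 2) ** X ** mat_powr \<rho> (1 / 2)) ** R)"

definition ac_fixed_points ::
  "(complex^'n^'n) set \<Rightarrow> (complex^'n^'n) set \<Rightarrow> complex^'n^'n \<Rightarrow> (complex^'n^'n) set" where
  "ac_fixed_points M N \<rho> = {X \<in> M. accardi_cecchini N \<rho> X = X}"

definition rel_entropy :: "complex^'n^'n \<Rightarrow> complex^'n^'n \<Rightarrow> complex" where
  "rel_entropy \<rho> \<sigma> = trace (\<rho> ** (mat_log \<rho> - mat_log \<sigma>))"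

end

theory Submission
  imports Defs
begin

text \<open>
  The equality case of the data processing inequality is read off from the relative modular
  operator $\Delta X = \sigma X \rho^{-1}$: the vectors $x_t = (t + \Delta)^{-1} 1$ and
  $y_t = (t + \Delta_N)^{-1} 1$ satisfy $\mathrm{Tr}\,\rho x_t - \mathrm{Tr}\,\rho_N y_t \ge 0$, with equality
  only if $x_t = y_t$, and the loss of relative entropy is the integral of this gap over $t > 0$.
  No loss therefore forces $f(\Delta) 1 = f(\Delta_N) 1$ for every $f$, that is
  $\sigma^a \rho^{-a} = \sigma_N^a \rho_N^{-a}$ for all real $a$.  By the cocycle identity the density
  $\sigma \rho^{-1}$ then lies in $C$, because $C$ consists of the $X \in N$ with
  $\rho^{1/2} X \rho^{-1/2} = \rho_N^{1/2} X \rho_N^{-1/2}$, and hence $\sigma_C = \sigma$.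

  Conversely, write $E_C$ for the trace-preserving expectation onto $C$. Since $C$ is invariant
  under $X \mapsto \rho^{-1} X \rho$, the matrix $k = E_C(\rho)^{-1} \rho$ commutes with $C$, and
  $\rho_C = \rho = E_C(\rho) k$, $\sigma_C = E_C(\sigma) k$ have the same relative entropy as $E_C(\rho)$ and
  $E_C(\sigma)$. By data processing along $C \subseteq N \subseteq M$ the relative entropy of $\rho_N$ and
  $\sigma_N$ lies between that of these and that of $\rho$ and $\sigma$.
\<close>

section \<open>Adjoints and the spectral theorem\<close>

lemma adj_adj [simp]: "adj (adj A) = A"
  by (simp add: adj_def vec_eq_iff)

lemma adj_mult: "adj (A ** B) = adj B ** adj A"
  by (simp add: adj_def matrix_matrix_mult_def vec_eq_iff mult.commute)

lemma adj_diff: "adj (A - B) = adj A - adj B"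
  by (simp add: adj_def vec_eq_iff)

lemma adj_mat [simp]: "adj (mat c) = mat (cnj c)"
  by (simp add: adj_def mat_def vec_eq_iff)

lemma adj_diag [simp]: "adj (diag d) = diag d"
  by (simp add: adj_def diag_def vec_eq_iff)

lemma trace_adj: "trace (adj A) = cnj (trace A)"
  by (simp add: trace_def adj_def)

lemma matrix_diff_ldistrib: "A ** (B - C) = A ** B - A ** C"
  for A B C :: "complex^'n^'n"
  by (simp add: matrix_matrix_mult_def vec_eq_iff sum_subtractf algebra_simps)

lemma matrix_diff_rdistrib: "(A - B) ** C = A ** C - B ** C"
  for A B C :: "complex^'n^'n"
  by (simp add: matrix_matrix_mult_def vec_eq_iff sum_subtractf algebra_simps)

lemma complex_matrix_add_rdistrib: "(A + B) ** C = A ** C + B ** C"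
  for A B C :: "complex^'n^'n"
  by (simp add: matrix_matrix_mult_def vec_eq_iff sum.distrib algebra_simps)

lemma matrix_mult_nth: "(A ** B) $ i $ j = (\<Sum>k\<in>UNIV. A $ i $ k * B $ k $ j)"
  by (simp add: matrix_matrix_mult_def)

lemma mat_mult_nth: "(mat c ** A) $ i $ j = c * A $ i $ j"
  for A :: "complex^'n^'n"
  by (simp add: matrix_matrix_mult_def mat_def if_distrib[of "\<lambda>x. x * _"] cong: if_cong)

lemma mult_mat_commute: "A ** mat c = mat c ** A" for A :: "complex^'n^'n"
  by (simp add: matrix_matrix_mult_def mat_def vec_eq_iff if_distrib[of "\<lambda>x. x * _"]
      if_distrib[of "\<lambda>x. _ * x"] mult.commute cong: if_cong)

lemma mat_mult_left_commute: "A ** (mat c ** B) = mat c ** (A ** B)"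
  for A B :: "complex^'n^'n"
  by (simp add: matrix_mul_assoc mult_mat_commute)

lemma trace_mat_mult: "trace (mat c ** A) = c * trace A" for A :: "complex^'n^'n"
  by (simp add: trace_def mat_mult_nth sum_distrib_left)

lemma matrix_inverse_commute: "A ** B = mat 1 \<Longrightarrow> B ** A = mat (1 :: complex)"
  for A B :: "complex^'n^'n"
  by (simp add: matrix_left_right_inverse)

lemma unitary_cancel:
  assumes "unitary U"
  shows "adj U ** U = mat 1" "U ** adj U = mat 1"
    "X ** adj U ** U = X" "X ** U ** adj U = X"
  using assms unfolding unitary_def by (simp_all flip: matrix_mul_assoc)

section \<open>Complex inner product of vectors and orthonormal eigenvectors\<close>

definition cdot :: "complex^'n \<Rightarrow> complex^'n \<Rightarrow> complex" where
  "cdot x y = (\<Sum>i\<in>UNIV. cnj (x $ i) * y $ i)"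

lemma Re_cdot: "Re (cdot x y) = inner x y"
  by (simp add: cdot_def inner_vec_def inner_complex_def)

lemma cdot_self: "cdot x x = complex_of_real ((norm x)\<^sup>2)"
proof -
  have "Im (cdot x x) = 0"
    by (simp add: cdot_def)
  moreover have "Re (cdot x x) = (norm x)\<^sup>2"
    by (simp add: Re_cdot power2_norm_eq_inner)
  ultimately show ?thesis
    by (simp add: complex_eq_iff)
qed

lemma cdot_commute: "cdot y x = cnj (cdot x y)"
  by (simp add: cdot_def mult.commute)

lemma cdot_add: "cdot x (y + z) = cdot x y + cdot x z"
  by (simp add: cdot_def algebra_simps sum.distrib)

lemma cdot_scaleR: "cdot x (c *\<^sub>R y) = c *\<^sub>R cdot x y"
  by (simp add: cdot_def scaleR_sum_right)

lemma cdot_ii: "cdot (\<i> *s x) y = - \<i> * cdot x y"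
  by (simp add: cdot_def sum_distrib_left mult.assoc sum_negf)

lemma cdot_adj: "cdot x (A *v y) = cdot (adj A *v x) y"
proof -
  have "cdot x (A *v y) = (\<Sum>i\<in>UNIV. \<Sum>j\<in>UNIV. cnj (x $ i) * (A $ i $ j * y $ j))"
    by (simp add: cdot_def matrix_vector_mult_def sum_distrib_left)
  also have "\<dots> = (\<Sum>j\<in>UNIV. \<Sum>i\<in>UNIV. cnj (x $ i) * (A $ i $ j * y $ j))"
    by (rule sum.swap)
  also have "\<dots> = cdot (adj A *v x) y"
    by (simp add: cdot_def matrix_vector_mult_def adj_def sum_distrib_left sum_distrib_right mult_ac)
  finally show ?thesis .
qed

lemma matrix_vector_scaleR: "A *v (c *\<^sub>R x) = c *\<^sub>R (A *v x)"
  for A :: "complex^'n^'m"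
  by (simp add: matrix_vector_mult_def vec_eq_iff scaleR_sum_right)

text \<open>Complex orthogonality to \<open>v\<close> is real orthogonality to both \<open>v\<close>
  and \<open>\<i> *s v\<close>. Doubling \<open>S\<close> in this way still leaves fewer real
  conditions than the real dimension.\<close>

lemma exists_cdot_orthogonal:
  fixes S :: "(complex^'n) set"
  assumes "finite S" "card S < CARD('n)"
  shows "\<exists>x. x \<noteq> 0 \<and> (\<forall>v\<in>S. cdot v x = 0)"
proof -
  let ?T = "S \<union> (\<lambda>v. \<i> *s v) ` S"
  have fin: "finite ?T"
    using assms by simp
  have "dim ?T \<le> card ?T"
    using fin by (rule dim_le_card')
  also have "card ?T \<le> card S + card S"
    by (meson assms(1) card_Un_le card_image_le add_left_mono order_trans)
  also have "\<dots> < DIM(complex^'n)"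
    using assms(2) by simp
  finally obtain x where x: "x \<noteq> 0" "\<forall>y\<in>span ?T. orthogonal x y"
    by (rule orthogonal_to_subspace_exists) blast
  have "cdot v x = 0" if "v \<in> S" for v
  proof -
    have "orthogonal x v" "orthogonal x (\<i> *s v)"
      using that by (auto intro!: bspec[OF x(2)] span_base)
    then have "Re (cdot v x) = 0" "Re (cdot (\<i> *s v) x) = 0"
      by (simp_all add: Re_cdot orthogonal_def inner_commute)
    then show ?thesis
      by (simp add: cdot_ii complex_eq_iff)
  qed
  then show ?thesis
    using x(1) by blast
qed

text \<open>The orthogonal complement \<open>W\<close> of \<open>S\<close> is invariant under
  \<open>A\<close>, since \<open>A\<close> is self-adjoint with real eigenvalues on
  \<open>S\<close>. A maximizer of the quadratic form on the unit sphere of \<open>W\<close> is an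
  eigenvector.\<close>

lemma hermitian_eigenvector_orthogonal:
  fixes A :: "complex^'n^'n"
  assumes A: "adj A = A" and S: "finite S" "card S < CARD('n)"
    and eig: "\<And>v. v \<in> S \<Longrightarrow> \<exists>\<mu>::real. A *v v = \<mu> *\<^sub>R v"
  shows "\<exists>u. norm u = 1 \<and> (\<forall>v\<in>S. cdot v u = 0) \<and> (\<exists>\<kappa>::real. A *v u = \<kappa> *\<^sub>R u)"
proof -
  define W where "W = {x. \<forall>v\<in>S. cdot v x = 0}"
  have W_add: "x + y \<in> W" if "x \<in> W" "y \<in> W" for x y
    using that by (simp add: W_def cdot_add)
  have W_scale: "c *\<^sub>R x \<in> W" if "x \<in> W" for x and c :: real
    using that by (simp add: W_def cdot_scaleR)
  have W_A: "A *v x \<in> W" if "x \<in> W" for x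
  proof -
    have "cdot v (A *v x) = 0" if v: "v \<in> S" for v
    proof -
      obtain \<mu> :: real where "A *v v = \<mu> *\<^sub>R v"
        using eig v by blast
      then have "cdot v (A *v x) = cdot (\<mu> *\<^sub>R v) x"
        by (simp add: cdot_adj A)
      also have "\<dots> = cnj (cdot x (\<mu> *\<^sub>R v))"
        by (rule cdot_commute)
      also have "\<dots> = 0"
        using \<open>x \<in> W\<close> v by (simp add: W_def cdot_scaleR flip: cdot_commute)
      finally show ?thesis .
    qed
    then show ?thesis
      by (simp add: W_def)
  qed
  define f where "f x = inner x (A *v x)" for x
  have cont: "continuous_on X f" for X
    unfolding f_def inner_vec_def matrix_vector_mult_def by (simp add: continuous_intros)
  have closed: "closed W"
  proof -
    have "W = (\<Inter>v\<in>S. {x. cdot v x = 0})"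
      by (auto simp: W_def)
    moreover have "closed {x. cdot v x = 0}" for v :: "complex^'n"
      unfolding cdot_def by (intro closed_Collect_eq continuous_intros)
    ultimately show ?thesis
      by (simp add: closed_INT)
  qed
  obtain x where x: "x \<noteq> 0" "x \<in> W"
    using exists_cdot_orthogonal[OF S] unfolding W_def by blast
  then have "inverse (norm x) *\<^sub>R x \<in> W \<inter> sphere 0 1"
    using W_scale by simp
  then have "W \<inter> sphere 0 1 \<noteq> {}"
    by blast
  moreover have "compact (W \<inter> sphere 0 1)"
    using closed by (intro closed_Int_compact) simp_all
  ultimately obtain u where u: "u \<in> W" "norm u = 1"
    and max: "\<And>y. y \<in> W \<Longrightarrow> norm y = 1 \<Longrightarrow> f y \<le> f u"
    using continuous_attains_sup[OF _ _ cont, of "W \<inter> sphere 0 1"] by (metis Int_iff mem_sphere_0)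
  define \<kappa> where "\<kappa> = f u"
  have bound: "f y \<le> \<kappa> * (norm y)\<^sup>2" if "y \<in> W" for y
  proof (cases "y = 0")
    case True
    then show ?thesis by (simp add: f_def)
  next
    case False
    have "f (inverse (norm y) *\<^sub>R y) \<le> \<kappa>"
      using False W_scale[OF that] unfolding \<kappa>_def by (intro max) auto
    then show ?thesis
      using False by (simp add: f_def matrix_vector_scaleR power2_eq_square field_simps)
  qed
  define y where "y = A *v u - \<kappa> *\<^sub>R u"
  have y: "y \<in> W"
    using W_add[OF W_A[OF u(1)] W_scale[OF u(1), of "- \<kappa>"]] by (simp add: y_def)
  have sym: "inner u (A *v y) = inner y (A *v u)"
  proof -
    have "Re (cdot u (A *v y)) = Re (cdot (A *v u) y)"
      by (simp add: cdot_adj A)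
    then show ?thesis
      by (simp add: Re_cdot inner_commute)
  qed
  let ?K = "\<kappa> * (norm y)\<^sup>2 - f y"
  \<comment> \<open>The maximizer \<open>u\<close> is moved in the direction of the residual
    \<open>y\<close>. The first-order gain \<open>2 * e * (norm y)\<^sup>2\<close> is bounded by a
    second-order term, so letting \<open>e\<close> tend to 0 forces \<open>y = 0\<close>.\<close>
  have perturb: "2 * (norm y)\<^sup>2 \<le> e * ?K" if "e > 0" for e :: real
  proof -
    have "f (u + e *\<^sub>R y) \<le> \<kappa> * (norm (u + e *\<^sub>R y))\<^sup>2"
      by (intro bound W_add W_scale u y)
    moreover have "f (u + e *\<^sub>R y) = \<kappa> + 2 * e * inner y (A *v u) + e\<^sup>2 * f y"
      by (simp add: f_def matrix_vector_right_distrib matrix_vector_scaleR \<kappa>_def inner_add_left inner_add_right sym power2_eq_square algebra_simps)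
    moreover have "(norm (u + e *\<^sub>R y))\<^sup>2 = 1 + 2 * e * inner y u + e\<^sup>2 * (norm y)\<^sup>2"
      using u(2) unfolding power2_norm_eq_inner norm_eq_1
      by (simp add: inner_add_left inner_add_right inner_commute power2_eq_square algebra_simps)
    moreover have "inner y (A *v u) = (norm y)\<^sup>2 + \<kappa> * inner y u"
      by (simp add: y_def power2_norm_eq_inner inner_diff_left inner_diff_right algebra_simps inner_commute)
    ultimately have "2 * e * (norm y)\<^sup>2 \<le> e\<^sup>2 * ?K"
      by (simp add: algebra_simps)
    then have "e * (2 * (norm y)\<^sup>2) \<le> e * (e * ?K)"
      by (simp add: power2_eq_square mult_ac)
    then show ?thesis
      using that by simp
  qed
  have "((\<lambda>e. e * ?K) \<longlongrightarrow> 0 * ?K) (at_right 0)"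
    by (intro tendsto_intros)
  moreover have "eventually (\<lambda>e. 2 * (norm y)\<^sup>2 \<le> e * ?K) (at_right 0)"
    by (rule eventually_mono[OF eventually_at_right_less]) (rule perturb)
  ultimately have "2 * (norm y)\<^sup>2 \<le> 0 * ?K"
    by (rule tendsto_lowerbound) simp
  then have "A *v u = \<kappa> *\<^sub>R u"
    by (simp add: y_def)
  then show ?thesis
    using u by (auto simp: W_def)
qed

text \<open>Having \<open>k\<close> arbitrary lets the induction add one eigenvector orthogonal to
  all earlier ones; \<open>k = CARD('n)\<close> gives an orthonormal basis.\<close>

lemma hermitian_eigenbasis:
  fixes A :: "complex^'n^'n"
  assumes A: "adj A = A" and "k \<le> CARD('n)"
  shows "\<exists>S. finite S \<and> card S = k \<and> (\<forall>v\<in>S. \<exists>\<mu>::real. A *v v = \<mu> *\<^sub>R v) \<and>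
    (\<forall>v\<in>S. \<forall>w\<in>S. cdot v w = (if v = w then 1 else 0))"
  using assms(2)
proof (induction k)
  case 0
  show ?case by (intro exI[of _ "{}"]) simp
next
  case (Suc k)
  then obtain S where S: "finite S" "card S = k"
    "\<And>v. v \<in> S \<Longrightarrow> \<exists>\<mu>::real. A *v v = \<mu> *\<^sub>R v"
    "\<And>v w. v \<in> S \<Longrightarrow> w \<in> S \<Longrightarrow> cdot v w = (if v = w then 1 else 0)"
    by fastforce
  obtain u and \<kappa> :: real where u: "norm u = 1" "\<And>v. v \<in> S \<Longrightarrow> cdot v u = 0"
    "A *v u = \<kappa> *\<^sub>R u"
    using hermitian_eigenvector_orthogonal[OF A S(1) _ S(3)] S(2) Suc.prems by auto
  have uu: "cdot u u = 1"
    using u(1) by (simp add: cdot_self)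
  then have "u \<notin> S"
    using u(2) by fastforce
  moreover have "cdot u v = 0" if "v \<in> S" for v
    using u(2)[OF that] cdot_commute[of u v] by simp
  ultimately show ?case
    using S u uu by (intro exI[of _ "insert u S"]) auto
qed

theorem hermitian_diagonalization:
  fixes A :: "complex^'n^'n"
  assumes A: "adj A = A"
  obtains U d where "unitary U" "A = U ** diag d ** adj U"
proof -
  obtain S where S: "finite S" "card S = CARD('n)"
    "\<forall>v\<in>S. \<exists>\<mu>::real. A *v v = \<mu> *\<^sub>R v"
    "\<forall>v\<in>S. \<forall>w\<in>S. cdot v w = (if v = w then 1 else 0)"
    using hermitian_eigenbasis[OF A order_refl] by blast
  obtain b :: "'n \<Rightarrow> complex^'n" where b: "bij_betw b UNIV S"
    using S(1,2) finite_same_card_bij[of "UNIV :: 'n set" S] by auto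
  have bS: "b i \<in> S" for i
    using b by (auto simp: bij_betw_def)
  have b_eq: "b i = b j \<longleftrightarrow> i = j" for i j
    using b by (auto simp: bij_betw_def inj_on_def)
  have "\<forall>i. \<exists>m::real. A *v b i = m *\<^sub>R b i"
    using S(3) bS by blast
  then obtain d :: "'n \<Rightarrow> real" where d: "\<forall>i. A *v b i = d i *\<^sub>R b i"
    by (rule choice[THEN exE])
  define U where "U = (\<chi> i j. b j $ i)"
  have "(adj U ** U) $ i $ j = mat 1 $ i $ j" for i j
  proof -
    have "(adj U ** U) $ i $ j = cdot (b i) (b j)"
      by (simp add: U_def adj_def matrix_matrix_mult_def cdot_def)
    then show ?thesis
      using S(4) bS[of i] bS[of j] by (simp add: b_eq mat_def)
  qed
  then have "adj U ** U = mat 1"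
    by (simp add: vec_eq_iff)
  then have U: "unitary U"
    by (simp add: unitary_def matrix_inverse_commute)
  have "(A ** U) $ i $ j = (U ** diag d) $ i $ j" for i j
  proof -
    have "(A ** U) $ i $ j = (A *v b j) $ i"
      by (simp add: U_def matrix_matrix_mult_def matrix_vector_mult_def)
    also have "\<dots> = d j *\<^sub>R (b j $ i)"
      by (simp add: d)
    also have "\<dots> = (U ** diag d) $ i $ j"
      by (simp add: matrix_mult_diag_right U_def scaleR_conv_of_real mult.commute)
    finally show ?thesis .
  qed
  then have "A ** U = U ** diag d"
    by (simp add: vec_eq_iff)
  then have "A = U ** diag d ** adj U"
    using unitary_cancel(4)[OF U] by metis
  then show thesis
    using U that by blast
qed

section \<open>Positive definite matrices\<close>

text \<open>The strict form merges positivity and invertibility. All eigenvalues are positive, so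
  logarithms and real powers obey their usual laws.\<close>

definition pos_def :: "complex^'n^'n \<Rightarrow> bool" where
  "pos_def A \<longleftrightarrow> adj A = A \<and> (\<forall>x. x \<noteq> 0 \<longrightarrow> 0 < Re (cdot x (A *v x)))"

lemma pos_def_adj [simp]: "pos_def A \<Longrightarrow> adj A = A"
  by (simp add: pos_def_def)

lemma unitary_vector_cancel:
  assumes "unitary U"
  shows "adj U *v (U *v x) = x" "U *v (adj U *v x) = x"
  using assms by (simp_all add: matrix_vector_mul_assoc unitary_def)

lemma matrix_vector_mult_diag: "(diag d *v x) $ i = complex_of_real (d i) * x $ i"
  by (simp add: matrix_vector_mult_def diag_def if_distrib[of "\<lambda>x. x * _"] cong: if_cong)

lemma cdot_diagonalized:
  "cdot x ((U ** diag d ** adj U) *v x) = (\<Sum>i\<in>UNIV. of_real (d i * (cmod ((adj U *v x) $ i))\<^sup>2))"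
proof -
  let ?y = "adj U *v x"
  have "cdot x ((U ** diag d ** adj U) *v x) = cdot x (U *v (diag d *v ?y))"
    by (simp add: matrix_vector_mul_assoc matrix_mul_assoc)
  also have "\<dots> = cdot ?y (diag d *v ?y)"
    by (rule cdot_adj)
  also have "\<dots> = (\<Sum>i\<in>UNIV. of_real (d i * (cmod (?y $ i))\<^sup>2))"
    unfolding cdot_def matrix_vector_mult_diag
    by (intro sum.cong refl) (simp add: mult_ac flip: complex_norm_square)
  finally show ?thesis .
qed

lemma cdot_diagonalized_axis:
  assumes "unitary U"
  shows "cdot (U *v axis i 1) ((U ** diag d ** adj U) *v (U *v axis i 1)) = of_real (d i)"
  using assms unfolding cdot_diagonalized
  by (simp add: unitary_vector_cancel axis_def if_distrib[of cmod] if_distrib[of "\<lambda>x. x ^ 2"]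
      if_distrib[of "\<lambda>x. _ * x"] if_distrib[of of_real] cong: if_cong)

lemma unitary_axis_nonzero:
  assumes "unitary U"
  shows "U *v axis i 1 \<noteq> 0"
proof
  assume "U *v axis i 1 = 0"
  then have "adj U *v (U *v axis i 1) = 0"
    by simp
  then show False
    using assms by (simp add: unitary_vector_cancel axis_eq_0_iff)
qed

lemma pos_def_diagonalized_iff:
  assumes U: "unitary U"
  shows "pos_def (U ** diag d ** adj U) \<longleftrightarrow> (\<forall>i. 0 < d i)"
proof
  assume A: "pos_def (U ** diag d ** adj U)"
  then show "\<forall>i. 0 < d i"
    using unitary_axis_nonzero[OF U] cdot_diagonalized_axis[OF U, of _ d]
    unfolding pos_def_def by (metis Re_complex_of_real)
next
  assume d: "\<forall>i. 0 < d i"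
  have "0 < Re (cdot x ((U ** diag d ** adj U) *v x))" if "x \<noteq> 0" for x
  proof -
    let ?y = "adj U *v x"
    have "?y \<noteq> 0"
      using that unitary_vector_cancel(2)[OF U, of x] by auto
    then obtain i where "?y $ i \<noteq> 0"
      by (auto simp: vec_eq_iff)
    then have "0 < (\<Sum>i\<in>UNIV. d i * (cmod (?y $ i))\<^sup>2)"
      using d by (intro sum_pos2[of UNIV i]) (simp_all add: less_imp_le)
    then show ?thesis
      unfolding cdot_diagonalized by simp
  qed
  then show "pos_def (U ** diag d ** adj U)"
    by (simp add: pos_def_def adj_mult matrix_mul_assoc)
qed

lemma pos_def_diagonalization:
  assumes "pos_def A"
  obtains U d where "unitary U" "\<forall>i. 0 < d i" "A = U ** diag d ** adj U"
  using assms hermitian_diagonalization pos_def_diagonalized_iff pos_def_adj by metis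

text \<open>Positivity makes each \<open>d i\<close> nonnegative, and invertibility excludes 0
  because \<open>U *v axis i 1\<close> is an eigenvector for \<open>d i\<close>.\<close>

lemma faithful_state_pos_def:
  assumes "faithful_state M \<rho>"
  shows "pos_def \<rho>"
proof -
  have pos: "positive_mat \<rho>" and inv: "invertible \<rho>"
    using assms by (auto simp: faithful_state_def)
  then have "adj \<rho> = \<rho>"
    by (simp add: positive_mat_def)
  then obtain U d where U: "unitary U" "\<rho> = U ** diag d ** adj U"
    by (rule hermitian_diagonalization)
  have "0 < d i" for i
  proof -
    have "0 \<le> Re (cdot (U *v axis i 1) (\<rho> *v (U *v axis i 1)))"
      using pos by (simp add: positive_mat_def cdot_def)
    then have "0 \<le> d i"
      unfolding U(2) cdot_diagonalized_axis[OF U(1)] by simp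
    moreover have "d i \<noteq> 0"
    proof
      assume "d i = 0"
      then have "diag d *v axis i 1 = 0"
        by (auto simp: vec_eq_iff matrix_vector_mult_diag axis_def)
      moreover have "\<rho> *v (U *v axis i 1) = U *v (diag d *v axis i 1)"
        using U by (simp add: matrix_vector_mul_assoc unitary_cancel)
      ultimately have "\<rho> *v (U *v axis i 1) = \<rho> *v 0"
        by simp
      then show False
        using inj_matrix_vector_mult[OF inv] unitary_axis_nonzero[OF U(1)]
        by (blast dest: injD)
    qed
    ultimately show ?thesis
      by simp
  qed
  then show ?thesis
    using U by (simp add: pos_def_diagonalized_iff)
qed

lemma pos_def_congruence:
  assumes A: "pos_def A" and w: "invertible w"
  shows "pos_def (adj w ** A ** w)"
proof -
  have "0 < Re (cdot x ((adj w ** A ** w) *v x))" if "x \<noteq> 0" for x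
  proof -
    have "w *v x \<noteq> 0"
      using that inj_matrix_vector_mult[OF w] by (metis injD matrix_vector_mult_0_right)
    then have "0 < Re (cdot (w *v x) (A *v (w *v x)))"
      using A by (simp add: pos_def_def)
    then show ?thesis
      using cdot_adj[of x "adj w" "A *v (w *v x)"] by (simp add: matrix_vector_mul_assoc matrix_mul_assoc)
  qed
  then show ?thesis
    using A by (simp add: pos_def_def adj_mult matrix_mul_assoc)
qed

lemma pos_def_mat_1: "pos_def (mat 1)"
  by (simp add: pos_def_def Re_cdot)

lemma trace_congruence: "trace (adj X ** A ** X) = (\<Sum>j\<in>UNIV. cdot (column j X) (A *v column j X))"
proof -
  have "(adj X ** (A ** X)) $ j $ j = cdot (column j X) (A *v column j X)" for j
    by (simp add: matrix_matrix_mult_def cdot_def adj_def column_def matrix_vector_mult_def)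
  then show ?thesis
    by (simp add: trace_def flip: matrix_mul_assoc)
qed

text \<open>The trace is the sum of the quadratic form of \<open>A\<close> over the columns of
  \<open>X\<close>, at least one of which is nonzero.\<close>

lemma trace_congruence_pos:
  assumes A: "pos_def A" and X: "X \<noteq> 0"
  shows "0 < Re (trace (adj X ** A ** X))"
proof -
  have nonneg: "0 \<le> Re (cdot x (A *v x))" for x
    using A by (cases "x = 0") (auto simp: pos_def_def cdot_def less_imp_le)
  obtain j where "column j X \<noteq> 0"
    using X by (auto simp: vec_eq_iff column_def)
  then have "0 < (\<Sum>j\<in>UNIV. Re (cdot (column j X) (A *v column j X)))"
    using A nonneg by (intro sum_pos2[of UNIV j]) (auto simp: pos_def_def)
  then show ?thesis
    by (simp add: trace_congruence)
qed

lemma trace_congruence_eq_0: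
  assumes "pos_def A" "trace (adj X ** A ** X) = 0"
  shows "X = 0"
  using trace_congruence_pos[OF assms(1)] assms(2) by fastforce

lemma trace_adj_self_eq_0:
  assumes "trace (adj X ** X) = 0"
  shows "X = 0"
  using trace_congruence_eq_0[OF pos_def_mat_1, of X] assms by simp

lemma trace_mult_commute: "trace (A ** B) = trace (B ** A)" for A B :: "complex^'n^'n"
  by (rule trace_mul_sym)

lemma trace_rotate: "trace (A ** B ** C) = trace (C ** A ** B)" for A B C :: "complex^'n^'n"
  using trace_mul_sym[of "A ** B" C] by (simp add: matrix_mul_assoc)

section \<open>Functional calculus\<close>

lemma diag_mult: "diag d ** diag e = diag (\<lambda>i. d i * e i)"
  by (auto simp: vec_eq_iff matrix_mult_diag_left) (simp add: diag_def)

lemma unitary_conj_mult: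
  assumes "unitary U"
  shows "(U ** X ** adj U) ** (U ** Y ** adj U) = U ** (X ** Y) ** adj U"
  using assms by (simp add: matrix_mul_assoc unitary_cancel)

lemma fun_calc_mult:
  assumes "adj A = A"
  shows "fun_calc f A ** fun_calc g A = fun_calc (\<lambda>x. f x * g x) A"
proof -
  obtain U d where U: "unitary U" "A = U ** diag d ** adj U"
    using hermitian_diagonalization[OF assms] .
  then show ?thesis
    by (simp add: fun_calc_diagonalized unitary_conj_mult diag_mult o_def)
qed

lemma adj_fun_calc:
  assumes "adj A = A"
  shows "adj (fun_calc f A) = fun_calc f A"
proof -
  obtain U d where U: "unitary U" "A = U ** diag d ** adj U"
    using hermitian_diagonalization[OF assms] .
  then show ?thesis
    by (simp add: fun_calc_diagonalized adj_mult matrix_mul_assoc)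
qed

lemma mat_powr_diagonalized:
  "unitary U \<Longrightarrow> mat_powr (U ** diag d ** adj U) a = U ** diag (\<lambda>i. d i powr a) ** adj U"
  by (simp add: mat_powr_def fun_calc_diagonalized o_def)

lemma pos_def_mat_powr:
  assumes "pos_def A"
  shows "pos_def (mat_powr A a)"
proof -
  obtain U d where U: "unitary U" "\<forall>i. 0 < d i" "A = U ** diag d ** adj U"
    using pos_def_diagonalization[OF assms] .
  then show ?thesis
    by (simp add: mat_powr_diagonalized pos_def_diagonalized_iff) (metis less_irrefl)
qed

lemma mat_powr_add:
  assumes "pos_def A"
  shows "mat_powr A a ** mat_powr A b = mat_powr A (a + b)"
  using assms by (simp add: mat_powr_def fun_calc_mult powr_add)

lemma mat_powr_0:
  assumes "pos_def A"
  shows "mat_powr A 0 = mat 1"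
proof -
  obtain U d where U: "unitary U" "\<forall>i. 0 < d i" "A = U ** diag d ** adj U"
    using pos_def_diagonalization[OF assms] .
  \<comment> \<open>Nonzero eigenvalues matter here, because \<open>0 powr 0\<close> is 0.\<close>
  have "d i \<noteq> 0" for i
    using U(2) by (metis less_irrefl)
  then have "diag (\<lambda>i. d i powr 0) = mat 1"
    by (simp add: diag_def mat_def vec_eq_iff)
  then show ?thesis
    using U by (simp add: mat_powr_diagonalized unitary_cancel)
qed

lemma mat_powr_1:
  assumes "pos_def A"
  shows "mat_powr A 1 = A"
proof -
  obtain U d where U: "unitary U" "\<forall>i. 0 < d i" "A = U ** diag d ** adj U"
    using pos_def_diagonalization[OF assms] .
  then have "diag (\<lambda>i. d i powr 1) = diag d"
    by (simp add: diag_def vec_eq_iff less_imp_le)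
  then show ?thesis
    using U by (simp add: mat_powr_diagonalized)
qed

lemma mat_powr_cancel:
  assumes "pos_def A" "a + b = 0"
  shows "mat_powr A a ** mat_powr A b = mat 1" "X ** mat_powr A a ** mat_powr A b = X"
  using assms by (simp_all add: mat_powr_add mat_powr_0 flip: matrix_mul_assoc)

lemma mat_powr_minus_1:
  assumes "pos_def A"
  shows "mat_powr A (- 1) ** A = mat 1" "A ** mat_powr A (- 1) = mat 1"
    "X ** mat_powr A (- 1) ** A = X" "X ** A ** mat_powr A (- 1) = X"
  using mat_powr_cancel[OF assms, of "- 1" 1] mat_powr_cancel[OF assms, of 1 "- 1"] assms
  by (simp_all add: mat_powr_1)

lemma mat_powr_half:
  assumes "pos_def A"
  shows "mat_powr A (1 / 2) ** mat_powr A (1 / 2) = A" "X ** mat_powr A (1 / 2) ** mat_powr A (1 / 2) = X ** A"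
  using assms by (simp_all add: mat_powr_add mat_powr_1 flip: matrix_mul_assoc)

lemma invertible_pos_def:
  assumes "pos_def A"
  shows "invertible A"
  using mat_powr_minus_1[OF assms] unfolding invertible_def by blast

lemma scaleR_eq_mat_mult: "c *\<^sub>R A = mat (complex_of_real c) ** A" for A :: "complex^'n^'n"
  by (simp add: vec_eq_iff mat_mult_nth) (simp add: scaleR_conv_of_real)

lemma matrix_mult_scaleR:
  fixes A B :: "complex^'n^'n"
  shows "A ** (c *\<^sub>R B) = c *\<^sub>R (A ** B)" "(c *\<^sub>R A) ** B = c *\<^sub>R (A ** B)"
  by (simp_all add: scaleR_eq_mat_mult mat_mult_left_commute flip: matrix_mul_assoc)

lemma trace_scaleR: "trace (c *\<^sub>R A) = complex_of_real c * trace A" for A :: "complex^'n^'n"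
  by (simp add: scaleR_eq_mat_mult trace_mat_mult)

section \<open>Subalgebras and their closure under functional calculus\<close>

lemma vn_algebraD:
  assumes "vn_algebra N"
  shows "mat 1 \<in> N" "X \<in> N \<Longrightarrow> Y \<in> N \<Longrightarrow> X + Y \<in> N" "X \<in> N \<Longrightarrow> Y \<in> N \<Longrightarrow> X ** Y \<in> N"
    "X \<in> N \<Longrightarrow> mat c ** X \<in> N" "X \<in> N \<Longrightarrow> r *\<^sub>R X \<in> N" "X \<in> N \<Longrightarrow> adj X \<in> N" "0 \<in> N"
proof -
  show "mat 1 \<in> N" "X \<in> N \<Longrightarrow> Y \<in> N \<Longrightarrow> X + Y \<in> N" "X \<in> N \<Longrightarrow> Y \<in> N \<Longrightarrow> X ** Y \<in> N"
    "X \<in> N \<Longrightarrow> adj X \<in> N"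
    using assms by (simp_all add: vn_algebra_def)
  show mat: "X \<in> N \<Longrightarrow> mat c ** X \<in> N" for c
    using assms by (simp add: vn_algebra_def)
  then show "X \<in> N \<Longrightarrow> r *\<^sub>R X \<in> N" for r
    by (simp add: scaleR_eq_mat_mult)
  have "mat 0 ** mat 1 \<in> N"
    using assms unfolding vn_algebra_def by blast
  then show "0 \<in> N"
    by simp
qed

lemma vn_algebra_diff:
  assumes "vn_algebra N" "X \<in> N" "Y \<in> N"
  shows "X - Y \<in> N"
  using vn_algebraD(2)[OF assms(1,2) vn_algebraD(5)[OF assms(1,3), of "- 1"]] by simp

lemma unitary_conj_add: "U ** diag (\<lambda>i. d i + e i) ** adj U = U ** diag d ** adj U + U ** diag e ** adj U"
proof -
  have "diag (\<lambda>i. d i + e i) = diag d + diag e"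
    by (simp add: diag_def vec_eq_iff)
  then show ?thesis
    by (simp add: matrix_add_ldistrib complex_matrix_add_rdistrib)
qed

lemma unitary_conj_const:
  fixes U :: "complex^'n^'n"
  assumes "unitary U"
  shows "U ** diag (\<lambda>i. c) ** adj U = mat (complex_of_real c)"
proof -
  have "diag (\<lambda>i. c) = (mat (complex_of_real c) :: complex^'n^'n)"
    by (simp add: diag_def mat_def vec_eq_iff)
  then show ?thesis
    using assms by (simp add: mult_mat_commute[of U] unitary_def flip: matrix_mul_assoc)
qed

text \<open>Lagrange interpolation on the spectrum writes every function as a polynomial.\<close>

lemma fun_calc_mem:
  assumes N: "vn_algebra N" and A: "A \<in> N" "adj A = A"
  shows "fun_calc f A \<in> N"
proof -
  obtain U d where U: "unitary U" "A = U ** diag d ** adj U"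
    using hermitian_diagonalization[OF A(2)] .
  define P where "P = {g. U ** diag (\<lambda>i. g (d i)) ** adj U \<in> N}"
  have P_const: "(\<lambda>x. c) \<in> P" for c
  proof -
    have "mat (complex_of_real c) ** mat 1 \<in> N"
      by (rule vn_algebraD(4)[OF N vn_algebraD(1)[OF N]])
    then show ?thesis
      unfolding P_def mem_Collect_eq unitary_conj_const[OF U(1)] by simp
  qed
  have P_add: "(\<lambda>x. g x + h x) \<in> P" if "g \<in> P" "h \<in> P" for g h
    using that vn_algebraD(2)[OF N] by (simp add: P_def unitary_conj_add)
  have P_mult: "(\<lambda>x. g x * h x) \<in> P" if "g \<in> P" "h \<in> P" for g h
    using that vn_algebraD(3)[OF N]
    unfolding P_def mem_Collect_eq by (simp flip: diag_mult unitary_conj_mult[OF U(1)])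
  have P_id: "(\<lambda>x. x) \<in> P"
    using A(1) U(2) by (simp add: P_def)
  have P_sum: "(\<lambda>x. \<Sum>a\<in>S. g a x) \<in> P" if "finite S" "\<And>a. a \<in> S \<Longrightarrow> g a \<in> P" for S :: "real set" and g
    using that by (induction S) (simp_all add: P_const P_add)
  have P_prod: "(\<lambda>x. \<Prod>a\<in>S. g a x) \<in> P" if "finite S" "\<And>a. a \<in> S \<Longrightarrow> g a \<in> P" for S :: "real set" and g
    using that by (induction S) (simp_all add: P_const P_mult)
  \<comment> \<open>The Lagrange polynomial with value \<open>f a\<close> at \<open>a\<close> and 0
    at the other eigenvalues, built only from sums, products and constants, under which
    \<open>P\<close> is closed.\<close>
  define L where "L a x = f a * (\<Prod>b\<in>range d - {a}. (x + - b) * inverse (a - b))" for a x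
  have L: "L a \<in> P" for a
    unfolding L_def[abs_def] by (intro P_mult P_const P_prod P_add P_id) auto
  have L_eval: "L a x = (if x = a then f a else 0)" if "x \<in> range d" for a x
  proof (cases "x = a")
    case True
    have "(\<Prod>b\<in>range d - {a}. (a + - b) * inverse (a - b)) = (\<Prod>b\<in>range d - {a}. 1)"
      by (intro prod.cong) auto
    then show ?thesis
      using True by (simp add: L_def)
  next
    case False
    then show ?thesis
      using that by (auto simp: L_def)
  qed
  have "(\<Sum>a\<in>range d. L a (d i)) = f (d i)" for i
    by (simp add: L_eval)
  moreover have "(\<lambda>x. \<Sum>a\<in>range d. L a x) \<in> P"
    by (intro P_sum L) simp
  ultimately have "U ** diag (\<lambda>i. f (d i)) ** adj U \<in> N"
    by (simp add: P_def)
  then show ?thesis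
    using U by (simp add: fun_calc_diagonalized o_def)
qed

lemma mat_powr_mem: "vn_algebra N \<Longrightarrow> A \<in> N \<Longrightarrow> pos_def A \<Longrightarrow> mat_powr A a \<in> N"
  by (simp add: mat_powr_def fun_calc_mem)

section \<open>The trace-preserving expectation\<close>

lemma inner_matrix_trace: "inner X Y = Re (trace (adj X ** Y))"
proof -
  have "inner X Y = (\<Sum>i\<in>UNIV. \<Sum>j\<in>UNIV. Re (cnj (X $ i $ j) * Y $ i $ j))"
    by (simp add: inner_vec_def inner_complex_def)
  also have "\<dots> = (\<Sum>j\<in>UNIV. \<Sum>i\<in>UNIV. Re (cnj (X $ i $ j) * Y $ i $ j))"
    by (rule sum.swap)
  also have "\<dots> = Re (trace (adj X ** Y))"
    by (simp add: trace_def adj_def matrix_matrix_mult_def)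
  finally show ?thesis .
qed

lemma vn_algebra_span:
  assumes "vn_algebra N"
  shows "span N = N"
proof -
  have "subspace N"
    using vn_algebraD(2,5,7)[OF assms] by (auto simp: subspace_def)
  then show ?thesis
    by (simp add: span_eq_iff)
qed

lemma trace_separating:
  assumes N: "vn_algebra N" and "Y \<in> N" "\<And>Z. Z \<in> N \<Longrightarrow> trace (Z ** Y) = 0"
  shows "Y = 0"
  using assms(2,3) vn_algebraD(6)[OF N] by (intro trace_adj_self_eq_0) blast

lemma trace_expectation_eqI:
  assumes N: "vn_algebra N" and Y: "Y \<in> N" "\<And>Z. Z \<in> N \<Longrightarrow> trace (Z ** Y) = trace (Z ** X)"
  shows "trace_expectation N X = Y"
  unfolding trace_expectation_def orth_proj_def
proof (rule the_equality)
  show "Y \<in> N \<and> (\<forall>Z\<in>N. hs_inner Z (X - Y) = 0)"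
    using Y vn_algebraD(6)[OF N] by (simp add: hs_inner_def matrix_diff_ldistrib trace_sub)
next
  fix Y' assume Y': "Y' \<in> N \<and> (\<forall>Z\<in>N. hs_inner Z (X - Y') = 0)"
  have "trace (Z ** (Y' - Y)) = 0" if "Z \<in> N" for Z
  proof -
    have "hs_inner (adj Z) (X - Y') = 0"
      using Y' that vn_algebraD(6)[OF N] by blast
    then show ?thesis
      using Y(2)[OF that] by (simp add: hs_inner_def matrix_diff_ldistrib trace_sub)
  qed
  then have "Y' - Y = 0"
    using Y' Y(1) by (intro trace_separating[OF N] vn_algebra_diff[OF N]) auto
  then show "Y' = Y"
    by simp
qed

text \<open>Real orthogonal decomposition only makes the real parts vanish. As \<open>N\<close>
  contains \<open>mat \<i> ** Z\<close> along with \<open>Z\<close>, the imaginary parts vanish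
  too.\<close>

lemma trace_expectation_exists:
  assumes N: "vn_algebra N"
  shows "\<exists>Y\<in>N. \<forall>Z\<in>N. trace (Z ** Y) = trace (Z ** X)"
proof -
  obtain Y W where Y: "Y \<in> span N" and W: "\<And>Z. Z \<in> span N \<Longrightarrow> orthogonal W Z" and X: "X = Y + W"
    by (rule orthogonal_subspace_decomp_exists[of N X]) (rule that)
  have Re0: "Re (trace (Z ** W)) = 0" if "Z \<in> N" for Z
  proof -
    have "inner (adj Z) W = 0"
      using W[of "adj Z"] that vn_algebraD(6)[OF N]
      by (simp add: vn_algebra_span[OF N] orthogonal_def inner_commute)
    then show ?thesis
      by (simp add: inner_matrix_trace)
  qed
  have "trace (Z ** W) = 0" if "Z \<in> N" for Z
    using Re0[OF that] Re0[OF vn_algebraD(4)[OF N that, of "\<i>"]]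
    by (simp add: trace_mat_mult complex_eq_iff flip: matrix_mul_assoc)
  then show ?thesis
    using Y unfolding vn_algebra_span[OF N] X by (intro bexI[of _ Y]) (simp_all add: matrix_add_ldistrib trace_add)
qed

lemma trace_expectation:
  assumes N: "vn_algebra N"
  shows trace_expectation_mem: "trace_expectation N X \<in> N"
    and trace_trace_expectation: "Z \<in> N \<Longrightarrow> trace (Z ** trace_expectation N X) = trace (Z ** X)"
proof -
  obtain Y where Y: "Y \<in> N" "\<forall>Z\<in>N. trace (Z ** Y) = trace (Z ** X)"
    using trace_expectation_exists[OF N] by blast
  then have "trace_expectation N X = Y"
    by (intro trace_expectation_eqI[OF N]) auto
  then show "trace_expectation N X \<in> N"
    "Z \<in> N \<Longrightarrow> trace (Z ** trace_expectation N X) = trace (Z ** X)"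
    using Y by auto
qed

lemma trace_trace_expectation':
  assumes "vn_algebra N" "Z \<in> N"
  shows "trace (trace_expectation N X ** Z) = trace (X ** Z)"
  using trace_trace_expectation[OF assms, of X] by (simp add: trace_mult_commute)

lemma trace_expectation_id:
  assumes "vn_algebra N" "X \<in> N"
  shows "trace_expectation N X = X"
  using assms by (intro trace_expectation_eqI) auto

text \<open>Half of the bimodule property: the factor from \<open>N\<close> is absorbed into the
  test matrix \<open>Z\<close>.\<close>

lemma trace_expectation_left:
  assumes N: "vn_algebra N" and Y: "Y \<in> N"
  shows "trace_expectation N (Y ** X) = Y ** trace_expectation N X"
proof (rule trace_expectation_eqI[OF N])
  show "Y ** trace_expectation N X \<in> N"
    using N Y by (intro vn_algebraD(3) trace_expectation_mem)
next
  fix Z assume "Z \<in> N"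
  then show "trace (Z ** (Y ** trace_expectation N X)) = trace (Z ** (Y ** X))"
    using trace_trace_expectation[OF N vn_algebraD(3)[OF N _ Y], of Z X] by (simp add: matrix_mul_assoc)
qed

lemma trace_expectation_right:
  assumes N: "vn_algebra N" and Y: "Y \<in> N"
  shows "trace_expectation N (X ** Y) = trace_expectation N X ** Y"
proof (rule trace_expectation_eqI[OF N])
  show "trace_expectation N X ** Y \<in> N"
    using N Y by (intro vn_algebraD(3) trace_expectation_mem)
next
  fix Z assume "Z \<in> N"
  then show "trace (Z ** (trace_expectation N X ** Y)) = trace (Z ** (X ** Y))"
    using trace_trace_expectation[OF N vn_algebraD(3)[OF N Y], of Z X]
    by (simp add: matrix_mul_assoc trace_rotate[of _ _ Y])
qed

lemma trace_expectation_adj: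
  assumes N: "vn_algebra N"
  shows "trace_expectation N (adj X) = adj (trace_expectation N X)"
proof (rule trace_expectation_eqI[OF N])
  show "adj (trace_expectation N X) \<in> N"
    using N by (intro vn_algebraD(6) trace_expectation_mem)
next
  fix Z assume Z: "Z \<in> N"
  have "trace (Z ** adj (trace_expectation N X)) = cnj (trace (trace_expectation N X ** adj Z))"
    by (simp add: adj_mult flip: trace_adj)
  also have "\<dots> = cnj (trace (X ** adj Z))"
    using Z N by (simp add: trace_trace_expectation' vn_algebraD(6))
  also have "\<dots> = trace (Z ** adj X)"
    by (simp add: adj_mult flip: trace_adj)
  finally show "trace (Z ** adj (trace_expectation N X)) = trace (Z ** adj X)" .
qed

lemma trace_expectation_add:
  assumes N: "vn_algebra N"
  shows "trace_expectation N (X + Y) = trace_expectation N X + trace_expectation N Y"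
  using N by (intro trace_expectation_eqI)
    (auto intro: vn_algebraD(2) trace_expectation_mem simp: matrix_add_ldistrib trace_add trace_trace_expectation)

lemma trace_expectation_scaleR:
  assumes N: "vn_algebra N"
  shows "trace_expectation N (c *\<^sub>R X) = c *\<^sub>R trace_expectation N X"
  unfolding scaleR_eq_mat_mult using N vn_algebraD(4)[OF N vn_algebraD(1)[OF N], of c]
  by (intro trace_expectation_left) simp_all

lemma trace_expectation_tower:
  assumes "vn_algebra N" "vn_algebra C" "C \<subseteq> N"
  shows "trace_expectation C (trace_expectation N X) = trace_expectation C X"
  using assms by (intro trace_expectation_eqI) (auto simp: trace_trace_expectation intro: trace_expectation_mem)

lemma trace_of_trace_expectation:
  assumes "vn_algebra N"
  shows "trace (trace_expectation N X) = trace X"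
  using trace_trace_expectation[OF assms vn_algebraD(1)[OF assms], of X] by simp

text \<open>Testing against the spectral projection of the expectation for its nonpositive eigenvalues.\<close>

lemma pos_def_trace_expectation:
  assumes N: "vn_algebra N" and A: "pos_def A"
  shows "pos_def (trace_expectation N A)"
proof -
  let ?B = "trace_expectation N A"
  have B: "adj ?B = ?B"
    using A by (simp flip: trace_expectation_adj[OF N])
  then obtain U d where U: "unitary U" "?B = U ** diag d ** adj U"
    by (rule hermitian_diagonalization)
  define P where "P = fun_calc (\<lambda>x. if x \<le> 0 then 1 else 0) ?B"
  have P_diag: "P = U ** diag (\<lambda>i. if d i \<le> 0 then 1 else 0) ** adj U"
    unfolding P_def U(2) using U(1) by (simp add: fun_calc_diagonalized o_def)
  have P: "P \<in> N" "adj P = P" "P ** P = P"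
    using B by (auto simp: P_def adj_fun_calc fun_calc_mult if_distrib[of "\<lambda>x. x * _"] cong: if_cong
        intro: fun_calc_mem[OF N trace_expectation_mem[OF N]])
  \<comment> \<open>As \<open>P\<close> lies in \<open>N\<close>, this trace is both a congruence of
    \<open>A\<close>, positive unless \<open>P = 0\<close>, and the sum of the nonpositive
    eigenvalues of \<open>?B\<close>.\<close>
  have "trace (adj P ** A ** P) = trace (P ** ?B)"
    using P N by (simp add: trace_rotate[of P A P] trace_trace_expectation)
  also have "\<dots> = trace (U ** (diag (\<lambda>i. if d i \<le> 0 then 1 else 0) ** diag d) ** adj U)"
    unfolding P_diag U(2) unitary_conj_mult[OF U(1)] ..
  also have "\<dots> = trace (diag (\<lambda>i. if d i \<le> 0 then d i else 0))"
    using U(1) by (simp add: trace_rotate[of U] unitary_def diag_mult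
        if_distrib[of "\<lambda>x. x * _"] cong: if_cong)
  finally have "Re (trace (adj P ** A ** P)) \<le> 0"
    by (simp add: trace_def diag_def sum_nonpos)
  then have "P = 0"
    using trace_congruence_pos[OF A, of P] by fastforce
  moreover have "adj U ** P ** U = diag (\<lambda>i. if d i \<le> 0 then 1 else 0)"
    using U(1) unfolding P_diag by (simp add: matrix_mul_assoc unitary_cancel)
  ultimately have "diag (\<lambda>i. if d i \<le> 0 then 1 else 0) $ i $ i = 0" for i
    by (metis times0_left times0_right zero_index)
  then have "\<forall>i. 0 < d i"
    by (simp add: diag_def) (metis not_le zero_neq_one)
  then show ?thesis
    unfolding U(2) by (simp add: pos_def_diagonalized_iff[OF U(1)])
qed

section \<open>Sums of simple fractions\<close>

text \<open>After equal poles are grouped, clearing denominators gives a polynomial \<open>p\<close>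
  with infinitely many roots. All grouped weights \<open>a x\<close> therefore vanish, and the
  fractions may be replaced by any function of the poles.\<close>

lemma simple_fractions_independent:
  fixes w :: "'a \<Rightarrow> complex" and l :: "'a \<Rightarrow> real" and f :: "real \<Rightarrow> complex"
  assumes I: "finite I" and zero: "\<And>t. 0 < t \<Longrightarrow> (\<Sum>i\<in>I. w i / of_real (t + l i)) = 0"
    and l: "\<And>i. i \<in> I \<Longrightarrow> 0 < l i"
  shows "(\<Sum>i\<in>I. w i * f (l i)) = 0"
proof -
  define a where "a x = (\<Sum>i | i \<in> I \<and> l i = x. w i)" for x
  have group: "(\<Sum>i\<in>I. w i * g (l i)) = (\<Sum>x\<in>l ` I. a x * g x)" for g :: "real \<Rightarrow> complex"
  proof -
    have "(\<Sum>i\<in>I. w i * g (l i)) = (\<Sum>x\<in>l ` I. \<Sum>i | i \<in> I \<and> l i = x. w i * g (l i))"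
      using I by (rule sum.image_gen)
    also have "\<dots> = (\<Sum>x\<in>l ` I. a x * g x)"
      by (intro sum.cong refl) (simp add: a_def sum_distrib_right)
    finally show ?thesis .
  qed
  define p where "p = (\<Sum>x\<in>l ` I. smult (a x) (\<Prod>y\<in>l ` I - {x}. [:complex_of_real y, 1:]))"
  have "poly p (of_real t) = 0" if t: "0 < t" for t
  proof -
    have nz: "complex_of_real t + of_real y \<noteq> 0" if "y \<in> l ` I" for y
    proof -
      have "t + y \<noteq> 0"
        using that t l by (auto dest!: l)
      then show ?thesis
        by (metis of_real_add of_real_eq_0_iff)
    qed
    have "poly p (of_real t) = (\<Sum>x\<in>l ` I. a x * (\<Prod>y\<in>l ` I - {x}. of_real t + of_real y))"
      by (simp add: p_def poly_sum poly_prod add.commute)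
    also have "\<dots> = (\<Sum>x\<in>l ` I. (\<Prod>y\<in>l ` I. of_real t + of_real y) * (a x * (1 / of_real (t + x))))"
    proof (intro sum.cong refl)
      fix x assume x: "x \<in> l ` I"
      then have "(\<Prod>y\<in>l ` I. of_real t + of_real y) =
          (of_real t + of_real x) * (\<Prod>y\<in>l ` I - {x}. complex_of_real t + of_real y)"
        using I by (intro prod.remove) auto
      then show "a x * (\<Prod>y\<in>l ` I - {x}. of_real t + of_real y) =
          (\<Prod>y\<in>l ` I. of_real t + of_real y) * (a x * (1 / of_real (t + x)))"
        using nz[OF x] by simp
    qed
    also have "\<dots> = (\<Prod>y\<in>l ` I. of_real t + of_real y) * (\<Sum>i\<in>I. w i * (1 / of_real (t + l i)))"
      unfolding group[of "\<lambda>x. 1 / of_real (t + x)"] by (rule sum_distrib_left[symmetric])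
    also have "\<dots> = 0"
      using zero[OF t] by simp
    finally show ?thesis .
  qed
  then have "complex_of_real ` {0<..} \<subseteq> {z. poly p z = 0}"
    by auto
  moreover have "infinite (complex_of_real ` {0<..})"
    using infinite_Ioi[of "0::real"] finite_imageD[of complex_of_real "{0<..}"]
    by (auto simp: inj_on_def)
  ultimately have p0: "p = 0"
    using poly_roots_finite finite_subset by blast
  have "a x = 0" if x: "x \<in> l ` I" for x
  proof -
    \<comment> \<open>Evaluation at the pole belonging to \<open>x\<close> removes every other
      summand and isolates \<open>a x\<close>.\<close>
    have "poly p (- of_real x) = (\<Sum>u\<in>l ` I. a u * (\<Prod>y\<in>l ` I - {u}. of_real y - of_real x))"
      by (simp add: p_def poly_sum poly_prod)
    also have "\<dots> = a x * (\<Prod>y\<in>l ` I - {x}. of_real y - of_real x)"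
    proof -
      have "(\<Prod>y\<in>l ` I - {u}. complex_of_real y - of_real x) = 0" if "u \<noteq> x" for u
        using that x I by (intro prod_zero) auto
      then have "(\<Sum>u\<in>l ` I - {x}. a u * (\<Prod>y\<in>l ` I - {u}. of_real y - of_real x)) = 0"
        by (intro sum.neutral) auto
      then show ?thesis
        using I x by (subst sum.remove[of _ x]) auto
    qed
    finally have "a x * (\<Prod>y\<in>l ` I - {x}. complex_of_real y - of_real x) = 0"
      using p0 by simp
    then show ?thesis
      using I by (auto simp: prod_zero_iff)
  qed
  then show ?thesis
    unfolding group by simp
qed

text \<open>The two sums are merged into one over the disjoint union, with the weights of the second
  negated.\<close>

lemma simple_fractions_eq:
  fixes w :: "'a \<Rightarrow> complex" and v :: "'b \<Rightarrow> complex" and f :: "real \<Rightarrow> complex"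
  assumes fin: "finite I" "finite J"
    and eq: "\<And>t. 0 < t \<Longrightarrow> (\<Sum>i\<in>I. w i / of_real (t + l i)) = (\<Sum>j\<in>J. v j / of_real (t + m j))"
    and pos: "\<And>i. i \<in> I \<Longrightarrow> 0 < l i" "\<And>j. j \<in> J \<Longrightarrow> 0 < m j"
  shows "(\<Sum>i\<in>I. w i * f (l i)) = (\<Sum>j\<in>J. v j * f (m j))"
proof -
  have split: "(\<Sum>k\<in>I <+> J. case_sum w (\<lambda>j. - v j) k * g (case_sum l m k)) =
      (\<Sum>i\<in>I. w i * g (l i)) - (\<Sum>j\<in>J. v j * g (m j))" for g :: "real \<Rightarrow> complex"
    using fin by (simp add: sum.Plus sum_negf)
  have "(\<Sum>k\<in>I <+> J. case_sum w (\<lambda>j. - v j) k * f (case_sum l m k)) = 0"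
  proof (rule simple_fractions_independent)
    fix t :: real assume "0 < t"
    then show "(\<Sum>k\<in>I <+> J. case_sum w (\<lambda>j. - v j) k / of_real (t + case_sum l m k)) = 0"
      using split[of "\<lambda>x. 1 / of_real (t + x)"] eq by simp
  qed (use fin pos in auto)
  then show ?thesis
    unfolding split by simp
qed

text \<open>The difference of the logarithmic sums at shift \<open>t\<close> is an antiderivative of the difference
  of the simple fractions, and it tends to 0 as \<open>t\<close> tends to infinity.\<close>

lemma log_sums:
  fixes p l :: "'a \<Rightarrow> real" and q m :: "'b \<Rightarrow> real"
  assumes total: "sum p I = sum q J"
    and pos: "\<And>i. i \<in> I \<Longrightarrow> 0 < l i" "\<And>j. j \<in> J \<Longrightarrow> 0 < m j"
    and frac: "\<And>t. 0 \<le> t \<Longrightarrow> (\<Sum>j\<in>J. q j / (t + m j)) \<le> (\<Sum>i\<in>I. p i / (t + l i))"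
  shows log_sum_le: "(\<Sum>i\<in>I. p i * ln (l i)) \<le> (\<Sum>j\<in>J. q j * ln (m j))"
    and log_sum_eq: "(\<Sum>i\<in>I. p i * ln (l i)) = (\<Sum>j\<in>J. q j * ln (m j)) \<Longrightarrow> 0 < t \<Longrightarrow>
      (\<Sum>j\<in>J. q j / (t + m j)) = (\<Sum>i\<in>I. p i / (t + l i))"
proof -
  define G where "G t = (\<Sum>i\<in>I. p i * ln (t + l i)) - (\<Sum>j\<in>J. q j * ln (t + m j))" for t
  define F where "F t = (\<Sum>i\<in>I. p i / (t + l i)) - (\<Sum>j\<in>J. q j / (t + m j))" for t
  have F: "0 \<le> F t" if "0 \<le> t" for t
    using frac[OF that] by (simp add: F_def)
  have deriv: "(G has_real_derivative F t) (at t)" if "0 \<le> t" for t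
    unfolding G_def F_def using that pos
    by (auto intro!: derivative_eq_intros sum.cong simp: add_nonneg_pos divide_inverse mult.commute)
  have mono: "G a \<le> G b" if "0 \<le> a" "a \<le> b" for a b
  proof (rule DERIV_nonneg_imp_nondecreasing[OF that(2)])
    fix x assume "a \<le> x" "x \<le> b"
    then show "\<exists>y. DERIV G x :> y \<and> 0 \<le> y"
      using deriv[of x] F[of x] that(1) by auto
  qed
  have ln_lim: "((\<lambda>t. ln (t + c) - ln t) \<longlongrightarrow> 0) at_top" if "0 < c" for c :: real
  proof -
    have "((\<lambda>t. ln (1 + c / t)) \<longlongrightarrow> ln (1 + 0)) at_top"
      by (intro tendsto_intros tendsto_divide_0[OF tendsto_const] filterlim_at_top_imp_at_infinity
          filterlim_ident) simp
    moreover have "eventually (\<lambda>t. ln (1 + c / t) = ln (t + c) - ln t) at_top"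
      using eventually_gt_at_top[of 0]
    proof eventually_elim
      case (elim t)
      then have "1 + c / t = (t + c) / t"
        by (simp add: field_simps)
      then show ?case
        using elim that by (simp add: ln_div)
    qed
    ultimately show ?thesis
      using tendsto_cong by fastforce
  qed
  have "((\<lambda>t. (\<Sum>i\<in>I. p i * (ln (t + l i) - ln t)) - (\<Sum>j\<in>J. q j * (ln (t + m j) - ln t))) \<longlongrightarrow>
      (\<Sum>i\<in>I. p i * 0) - (\<Sum>j\<in>J. q j * 0)) at_top"
    using pos by (intro tendsto_diff tendsto_sum tendsto_mult tendsto_const ln_lim)
  \<comment> \<open>Equal total weights cancel the multiples of \<open>ln t\<close>, so it is
    \<open>G\<close> itself that tends to 0.\<close>
  moreover have "(\<Sum>i\<in>I. p i * (ln (t + l i) - ln t)) - (\<Sum>j\<in>J. q j * (ln (t + m j) - ln t)) = G t" for t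
    using total by (simp add: G_def right_diff_distrib sum_subtractf flip: sum_distrib_right)
  ultimately have lim: "(G \<longlongrightarrow> 0) at_top"
    by simp
  have le0: "G t \<le> 0" if "0 \<le> t" for t
  proof (rule tendsto_lowerbound[OF lim])
    show "eventually (\<lambda>s. G t \<le> G s) at_top"
      using eventually_ge_at_top[of t] by (rule eventually_mono) (rule mono[OF that])
  qed simp
  then have "G 0 \<le> 0"
    by simp
  then show "(\<Sum>i\<in>I. p i * ln (l i)) \<le> (\<Sum>j\<in>J. q j * ln (m j))"
    by (simp add: G_def)
  assume eq: "(\<Sum>i\<in>I. p i * ln (l i)) = (\<Sum>j\<in>J. q j * ln (m j))" and t: "0 < t"
  \<comment> \<open>\<open>G\<close> is nondecreasing and at most 0, and equality of the logarithmic
    sums means \<open>G 0 = 0\<close>. So it is constant and its derivative \<open>F\<close>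
    vanishes.\<close>
  have "G s = 0" if "0 \<le> s" for s
    using mono[OF _ that] le0[OF that] eq by (simp add: G_def)
  then have "\<forall>y. \<bar>t - y\<bar> < t \<longrightarrow> G t = G y"
    using t by auto
  then have "F t = 0"
    using DERIV_local_const[OF deriv t] t by simp
  then show "(\<Sum>j\<in>J. q j / (t + m j)) = (\<Sum>i\<in>I. p i / (t + l i))"
    by (simp add: F_def)
qed

section \<open>The relative modular operator and the data processing inequality\<close>

text \<open>For \<open>\<sigma> = U ** diag s ** adj U\<close> and \<open>\<rho> = W ** diag r ** adj W\<close> this is \<open>f(\<Delta>)\<close> applied to the identity,
  where \<open>\<Delta>\<close> is the map \<open>X \<mapsto> \<sigma> X \<rho>\<^sup>-\<^sup>1\<close>.\<close>

definition relmod ::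
  "(real \<Rightarrow> real) \<Rightarrow> complex^'n^'n \<Rightarrow> ('n \<Rightarrow> real) \<Rightarrow> complex^'n^'n \<Rightarrow> ('n \<Rightarrow> real) \<Rightarrow> complex^'n^'n" where
  "relmod f U s W r =
     U ** (\<chi> i j. complex_of_real (f (s i / r j)) * (adj U ** W) $ i $ j) ** adj W"

text \<open>The weights in an entry do not depend on \<open>f\<close>. For
  \<open>f x = 1 / (t + x)\<close> the entry is thus a sum of simple fractions in
  \<open>t\<close>.\<close>

lemma relmod_nth:
  "relmod f U s W r $ k $ l = (\<Sum>(i, j)\<in>UNIV.
     (U $ k $ i * (adj U ** W) $ i $ j * adj W $ j $ l) * complex_of_real (f (s i / r j)))"
proof -
  define M where "M = adj U ** W"
  have "relmod f U s W r $ k $ l = (\<Sum>j\<in>UNIV. \<Sum>i\<in>UNIV.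
     (U $ k $ i * M $ i $ j * adj W $ j $ l) * complex_of_real (f (s i / r j)))"
    by (simp add: relmod_def matrix_mult_nth sum_distrib_right flip: M_def) (simp add: mult_ac)
  also have "\<dots> = (\<Sum>i\<in>UNIV. \<Sum>j\<in>UNIV.
     (U $ k $ i * M $ i $ j * adj W $ j $ l) * complex_of_real (f (s i / r j)))"
    by (rule sum.swap)
  finally show ?thesis
    by (simp add: sum.cartesian_product M_def)
qed

text \<open>For \<open>f = ln\<close> this real weighted sum is minus the relative entropy; for
  \<open>f x = 1 / (t + x)\<close> it supplies the fractions compared in
  \<open>log_sums\<close>.\<close>

lemma trace_relmod:
  assumes W: "unitary W"
  shows "trace (W ** diag r ** adj W ** relmod f U s W r) =
    complex_of_real (\<Sum>(i, j)\<in>UNIV. (r j * (cmod ((adj U ** W) $ i $ j))\<^sup>2) * f (s i / r j))"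
proof -
  define M where "M = adj U ** W"
  let ?K = "\<chi> i j. complex_of_real (f (s i / r j)) * M $ i $ j"
  have "trace (W ** diag r ** adj W ** relmod f U s W r) = trace ((W ** diag r ** adj W ** U) ** ?K ** adj W)"
    by (simp add: relmod_def matrix_mul_assoc M_def)
  also have "\<dots> = trace ((adj W ** W) ** diag r ** (adj W ** U ** ?K))"
    unfolding trace_rotate[of _ ?K] by (simp add: matrix_mul_assoc)
  also have "\<dots> = trace (diag r ** (adj M ** ?K))"
    using W by (simp add: unitary_def adj_mult M_def)
  also have "\<dots> = (\<Sum>j\<in>UNIV. \<Sum>i\<in>UNIV.
      complex_of_real ((r j * (cmod (M $ i $ j))\<^sup>2) * f (s i / r j)))"
    unfolding trace_def matrix_mult_diag_left
    by (simp add: matrix_mult_nth adj_def sum_distrib_left complex_norm_square mult_ac del: of_real_power)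
  also have "\<dots> = (\<Sum>i\<in>UNIV. \<Sum>j\<in>UNIV.
      complex_of_real ((r j * (cmod (M $ i $ j))\<^sup>2) * f (s i / r j)))"
    by (rule sum.swap)
  finally show ?thesis
    by (simp add: sum.cartesian_product M_def case_prod_beta)
qed

lemma relmod_const:
  assumes "unitary U" "unitary W"
  shows "relmod (\<lambda>x. 1) U s W r = mat 1"
proof -
  have "relmod (\<lambda>x. 1) U s W r = U ** (adj U ** W) ** adj W"
    by (simp add: relmod_def)
  then show ?thesis
    using assms by (simp add: matrix_mul_assoc unitary_cancel)
qed

text \<open>When \<open>f\<close> separates on the ratios of eigenvalues, f(\<Delta>) 1 reduces to
  ordinary functions of the two matrices.\<close>

lemma relmod_diag:
  assumes W: "unitary W" and eq: "\<And>i j. f (s i / r j) * b j = a i * c j"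
  shows "relmod f U s W r ** (W ** diag b ** adj W) =
    (U ** diag a ** adj U) ** (W ** diag c ** adj W)"
proof -
  let ?K = "\<chi> i j. complex_of_real (f (s i / r j)) * (adj U ** W) $ i $ j"
  have "?K ** diag b = diag a ** (adj U ** W) ** diag c"
  proof -
    have "complex_of_real (f (s i / r j)) * complex_of_real (b j) = complex_of_real (a i) * complex_of_real (c j)" for i j
      using eq[of i j] by (metis of_real_mult)
    then show ?thesis
      by (simp add: vec_eq_iff matrix_mult_diag_left matrix_mult_diag_right mult_ac)
  qed
  then show ?thesis
    using W by (simp add: relmod_def matrix_mul_assoc unitary_cancel) (simp flip: matrix_mul_assoc)
qed

lemma relmod_powr:
  assumes U: "unitary U" "\<forall>i. 0 < s i" and W: "unitary W" "\<forall>j. 0 < r j"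
  shows "relmod (\<lambda>x. x powr a) U s W r =
    mat_powr (U ** diag s ** adj U) a ** mat_powr (W ** diag r ** adj W) (- a)"
proof -
  have "relmod (\<lambda>x. x powr a) U s W r ** (W ** diag (\<lambda>j. 1) ** adj W) =
     (U ** diag (\<lambda>i. s i powr a) ** adj U) ** (W ** diag (\<lambda>j. r j powr (- a)) ** adj W)"
    using U W by (intro relmod_diag) (simp_all add: powr_divide less_imp_le powr_minus_divide)
  then show ?thesis
    using U W unitary_conj_const[OF W(1), of 1] by (simp add: mat_powr_diagonalized)
qed

lemma relmod_ln:
  assumes U: "unitary U" "\<forall>i. 0 < s i" and W: "unitary W" "\<forall>j. 0 < r j"
  shows "relmod ln U s W r = mat_log (U ** diag s ** adj U) - mat_log (W ** diag r ** adj W)"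
proof -
  let ?M = "adj U ** W"
  have nz: "s i \<noteq> 0" "r i \<noteq> 0" for i
    using U W by (metis less_irrefl, metis less_irrefl)
  have "(\<chi> i j. complex_of_real (ln (s i / r j)) * ?M $ i $ j) = diag (\<lambda>i. ln (s i)) ** ?M - ?M ** diag (\<lambda>j. ln (r j))"
    using U W nz by (simp add: vec_eq_iff matrix_mult_diag_left matrix_mult_diag_right ln_div algebra_simps)
  then have "relmod ln U s W r = U ** (diag (\<lambda>i. ln (s i)) ** ?M) ** adj W - U ** (?M ** diag (\<lambda>j. ln (r j))) ** adj W"
    by (simp add: relmod_def matrix_diff_ldistrib matrix_diff_rdistrib)
  also have "U ** (diag (\<lambda>i. ln (s i)) ** ?M) ** adj W = U ** diag (\<lambda>i. ln (s i)) ** adj U"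
    using W(1) by (simp add: matrix_mul_assoc unitary_cancel)
  also have "U ** (?M ** diag (\<lambda>j. ln (r j))) ** adj W = W ** diag (\<lambda>j. ln (r j)) ** adj W"
    using U(1) by (simp add: matrix_mul_assoc unitary_def)
  finally show ?thesis
    using U(1) W(1) by (simp add: mat_log_def fun_calc_diagonalized o_def)
qed

text \<open>This is (t + \<Delta>) x = 1 multiplied by \<rho> on the right. Without the inverse,
  both sides are linear in the densities and the expectation onto a subalgebra can be applied
  directly.\<close>

definition resolvent_eq :: "real \<Rightarrow> complex^'n^'n \<Rightarrow> complex^'n^'n \<Rightarrow> complex^'n^'n \<Rightarrow> bool" where
  "resolvent_eq t \<sigma> \<rho> x \<longleftrightarrow> t *\<^sub>R (x ** \<rho>) + \<sigma> ** x = \<rho>"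

text \<open>In the two eigenbases the equation becomes the scalar identity t r / (t + s/r) + s / (t
  + s/r) = r.\<close>

lemma resolvent_eq_relmod:
  assumes U: "unitary U" "\<forall>i. 0 < s i" and W: "unitary W" "\<forall>j. 0 < r j" and t: "0 \<le> t"
  shows "resolvent_eq t (U ** diag s ** adj U) (W ** diag r ** adj W) (relmod (\<lambda>x. 1 / (t + x)) U s W r)"
proof -
  let ?M = "adj U ** W"
  let ?K = "\<chi> i j. complex_of_real (1 / (t + s i / r j)) * ?M $ i $ j"
  have "t *\<^sub>R (?K ** diag r) + diag s ** ?K = ?M ** diag r"
  proof -
    have "t * (1 / (t + s i / r j) * r j) + s i * (1 / (t + s i / r j)) = r j" for i j
    proof -
      have "0 < s i" "0 < r j"
        using U W by auto
      moreover from this have "0 < t * r j + s i"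
        using t by (simp add: add_nonneg_pos)
      ultimately show ?thesis
        by (simp add: divide_simps) (simp add: algebra_simps)
    qed
    then have "complex_of_real t * (complex_of_real (1 / (t + s i / r j)) * complex_of_real (r j)) +
        complex_of_real (s i) * complex_of_real (1 / (t + s i / r j)) = complex_of_real (r j)" for i j
      by (metis of_real_add of_real_mult)
    then have "(complex_of_real t * (complex_of_real (1 / (t + s i / r j)) * complex_of_real (r j)) +
        complex_of_real (s i) * complex_of_real (1 / (t + s i / r j))) * ?M $ i $ j = complex_of_real (r j) * ?M $ i $ j" for i j
      by presburger
    then show ?thesis
      by (simp add: scaleR_eq_mat_mult vec_eq_iff mat_mult_nth matrix_mult_diag_left matrix_mult_diag_right algebra_simps
          del: of_real_divide)
  qed
  then have "U ** (t *\<^sub>R (?K ** diag r) + diag s ** ?K) ** adj W = U ** (?M ** diag r) ** adj W"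
    by simp
  then show ?thesis
    using U(1) W(1) by (simp add: resolvent_eq_def relmod_def matrix_add_ldistrib
        complex_matrix_add_rdistrib matrix_mult_scaleR matrix_mul_assoc unitary_cancel)
qed

lemma resolvent_zero:
  assumes pd: "pos_def \<sigma>" "pos_def \<rho>" and t: "0 \<le> t"
  shows "Re (trace (adj z ** (t *\<^sub>R (z ** \<rho>) + \<sigma> ** z))) \<ge> 0"
    and "Re (trace (adj z ** (t *\<^sub>R (z ** \<rho>) + \<sigma> ** z))) = 0 \<Longrightarrow> z = 0"
proof -
  have "trace (adj z ** z ** \<rho>) = trace (z ** \<rho> ** adj z)"
    using trace_rotate[of "adj z" z \<rho>] trace_rotate[of \<rho> "adj z" z] by simp
  then have "trace (adj z ** (t *\<^sub>R (z ** \<rho>))) = t * trace (adj (adj z) ** \<rho> ** adj z)"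
    by (simp add: matrix_mult_scaleR trace_scaleR matrix_mul_assoc)
  then have split: "Re (trace (adj z ** (t *\<^sub>R (z ** \<rho>) + \<sigma> ** z))) =
      t * Re (trace (adj (adj z) ** \<rho> ** adj z)) + Re (trace (adj z ** \<sigma> ** z))"
    by (simp add: matrix_add_ldistrib trace_add matrix_mul_assoc)
  have "0 \<le> Re (trace (adj (adj z) ** \<rho> ** adj z))"
    using trace_congruence_pos[OF pd(2), of "adj z"] by (cases "adj z = 0") (auto simp: trace_def)
  then have t: "0 \<le> t * Re (trace (adj (adj z) ** \<rho> ** adj z))"
    using t by simp
  moreover have "0 \<le> Re (trace (adj z ** \<sigma> ** z))"
    using trace_congruence_pos[OF pd(1), of z] by (cases "z = 0") (auto simp: trace_def)
  ultimately show "Re (trace (adj z ** (t *\<^sub>R (z ** \<rho>) + \<sigma> ** z))) \<ge> 0"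
    unfolding split by simp
  assume "Re (trace (adj z ** (t *\<^sub>R (z ** \<rho>) + \<sigma> ** z))) = 0"
  then show "z = 0"
    unfolding split using t trace_congruence_pos[OF pd(1), of z] by fastforce
qed

lemma resolvent_eq_unique:
  assumes pd: "pos_def \<sigma>" "pos_def \<rho>" and t: "0 \<le> t"
    and x: "resolvent_eq t \<sigma> \<rho> x" and y: "resolvent_eq t \<sigma> \<rho> y"
  shows "x = y"
proof -
  have "t *\<^sub>R ((x - y) ** \<rho>) + \<sigma> ** (x - y) = 0"
    using x y by (simp add: resolvent_eq_def matrix_diff_ldistrib matrix_diff_rdistrib algebra_simps)
  then have "x - y = 0"
    by (intro resolvent_zero(2)[OF pd t]) (simp add: trace_def)
  then show ?thesis
    by simp
qed

lemma resolvent_eq_expectation: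
  assumes N: "vn_algebra N" and "\<sigma> \<in> N" "\<rho> \<in> N" "resolvent_eq t \<sigma> \<rho> x"
  shows "resolvent_eq t \<sigma> \<rho> (trace_expectation N x)"
proof -
  have "trace_expectation N (t *\<^sub>R (x ** \<rho>) + \<sigma> ** x) = trace_expectation N \<rho>"
    using assms(4) by (simp add: resolvent_eq_def)
  then show ?thesis
    using assms(2,3) by (simp add: resolvent_eq_def trace_expectation_add[OF N] trace_expectation_scaleR[OF N]
        trace_expectation_left[OF N] trace_expectation_right[OF N] trace_expectation_id[OF N])
qed

text \<open>The expectation of a solution is again a solution, so uniqueness makes it equal to
  \<open>x\<close>.\<close>

lemma resolvent_eq_mem:
  assumes N: "vn_algebra N" and pd: "pos_def \<sigma>" "pos_def \<rho>" and mem: "\<sigma> \<in> N" "\<rho> \<in> N"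
    and t: "0 \<le> t" and x: "resolvent_eq t \<sigma> \<rho> x"
  shows "x \<in> N"
  using resolvent_eq_unique[OF pd t x resolvent_eq_expectation[OF N mem x]] trace_expectation_mem[OF N, of x]
  by simp

text \<open>The solution \<open>y\<close> over \<open>N\<close> is the projection of \<open>x\<close> onto \<open>N\<close> with respect to the positive form
  \<open>(w, v) \<mapsto> t Tr (w\<^sup>* v \<rho>) + Tr (w\<^sup>* \<sigma> v)\<close>, so the gap is the value of this form at \<open>x - y\<close>.\<close>

lemma resolvent_gap:
  assumes N: "vn_algebra N" and pd: "pos_def \<sigma>" "pos_def \<rho>" and t: "0 \<le> t"
    and x: "resolvent_eq t \<sigma> \<rho> x"
    and y: "resolvent_eq t (trace_expectation N \<sigma>) (trace_expectation N \<rho>) y"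
  shows "Re (trace (\<rho> ** x)) - Re (trace (trace_expectation N \<rho> ** y)) =
    Re (trace (adj (x - y) ** (t *\<^sub>R ((x - y) ** \<rho>) + \<sigma> ** (x - y))))"
proof -
  define B where "B w v = trace (adj w ** (t *\<^sub>R (v ** \<rho>) + \<sigma> ** v))" for w v
  have pdN: "pos_def (trace_expectation N \<sigma>)" "pos_def (trace_expectation N \<rho>)"
    using pd by (simp_all add: pos_def_trace_expectation[OF N])
  have yN: "y \<in> N"
    by (rule resolvent_eq_mem[OF N pdN _ _ t y]) (simp_all add: trace_expectation_mem[OF N])
  have Bx: "B w x = trace (adj w ** \<rho>)" for w
    using x by (simp add: B_def resolvent_eq_def)
  \<comment> \<open>Against \<open>w\<close> in \<open>N\<close>, the form at \<open>y\<close> is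
    the same whether built from \<rho>, \<sigma> or from their expectations, so there
    \<open>y\<close> behaves like \<open>x\<close>.\<close>
  have By: "B w y = trace (adj w ** \<rho>)" if w: "w \<in> N" for w
  proof -
    have w': "adj w \<in> N"
      using w vn_algebraD(6)[OF N] by blast
    have "trace_expectation N (adj w ** (t *\<^sub>R (y ** \<rho>) + \<sigma> ** y)) =
        adj w ** (t *\<^sub>R (y ** trace_expectation N \<rho>) + trace_expectation N \<sigma> ** y)"
      by (simp add: trace_expectation_left[OF N w'] trace_expectation_left[OF N yN] trace_expectation_right[OF N yN]
          trace_expectation_add[OF N] trace_expectation_scaleR[OF N])
    also have "\<dots> = trace_expectation N (adj w ** \<rho>)"
      using y by (simp add: resolvent_eq_def trace_expectation_left[OF N w'])
    finally show ?thesis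
      unfolding B_def by (metis trace_of_trace_expectation[OF N])
  qed
  have B_diff: "B w (u - v) = B w u - B w v" for w u v
    by (simp add: B_def matrix_diff_ldistrib matrix_diff_rdistrib scaleR_diff_right matrix_mult_scaleR trace_scaleR right_diff_distrib trace_sub matrix_add_ldistrib trace_add)
  have B_diff': "B (u - v) w = B u w - B v w" for w u v
    by (simp add: B_def adj_diff matrix_diff_rdistrib trace_sub)
  have B_sym: "B v w = cnj (B w v)" for w v
  proof -
    have "cnj (trace (adj w ** v ** \<rho>)) = trace (adj v ** w ** \<rho>)"
      using pd(2) trace_rotate[of "adj v" w \<rho>] by (simp add: adj_mult matrix_mul_assoc flip: trace_adj)
    moreover have "cnj (trace (adj w ** \<sigma> ** v)) = trace (adj v ** \<sigma> ** w)"
      using pd(1) by (simp add: adj_mult matrix_mul_assoc flip: trace_adj)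
    ultimately show ?thesis
      by (simp add: B_def matrix_add_ldistrib trace_add matrix_mult_scaleR
          trace_scaleR matrix_mul_assoc)
  qed
  have tr: "trace (adj w ** \<rho>) = cnj (trace (\<rho> ** w))" for w
    using pd(2) by (simp add: adj_mult flip: trace_adj)
  have "B (x - y) (x - y) = B x x - B x y - B y x + B y y"
    by (simp add: B_diff B_diff')
  \<comment> \<open>\<open>B y x\<close> and \<open>B y y\<close> cancel, and \<open>B x y\<close>
    is the conjugate of \<open>B y x\<close>.\<close>
  also have "\<dots> = cnj (trace (\<rho> ** x)) - trace (\<rho> ** y)"
    by (simp add: B_sym[of x y] Bx By[OF yN] tr)
  finally have "Re (B (x - y) (x - y)) = Re (trace (\<rho> ** x)) - Re (trace (\<rho> ** y))"
    by simp
  moreover have "trace (trace_expectation N \<rho> ** y) = trace (\<rho> ** y)"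
    by (rule trace_trace_expectation'[OF N yN])
  ultimately show ?thesis
    by (simp add: B_def)
qed

text \<open>By independence of simple fractions, applied to each entry, agreement of the resolvents
  passes to powers and logarithms.\<close>

lemma relmod_eqI:
  assumes U: "\<forall>i. 0 < s i" "\<forall>j. 0 < r j" and U': "\<forall>i. 0 < s' i" "\<forall>j. 0 < r' j"
    and eq: "\<And>t. 0 < t \<Longrightarrow> relmod (\<lambda>x. 1 / (t + x)) U s W r = relmod (\<lambda>x. 1 / (t + x)) U' s' W' r'"
  shows "relmod f U s W r = relmod f U' s' W' r'"
proof -
  have "relmod f U s W r $ k $ l = relmod f U' s' W' r' $ k $ l" for k l
    unfolding relmod_nth case_prod_beta
  proof (rule simple_fractions_eq[where f = "\<lambda>x. of_real (f x)"])
    fix t :: real assume "0 < t"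
    then have "relmod (\<lambda>x. 1 / (t + x)) U s W r $ k $ l = relmod (\<lambda>x. 1 / (t + x)) U' s' W' r' $ k $ l"
      using eq by simp
    then show "(\<Sum>p\<in>UNIV. U $ k $ fst p * (adj U ** W) $ fst p $ snd p * adj W $ snd p $ l /
          of_real (t + s (fst p) / r (snd p))) =
        (\<Sum>p\<in>UNIV. U' $ k $ fst p * (adj U' ** W') $ fst p $ snd p * adj W' $ snd p $ l /
          of_real (t + s' (fst p) / r' (snd p)))"
      unfolding relmod_nth case_prod_beta by (simp add: divide_inverse)
  qed (use U U' in simp_all)
  then show ?thesis
    by (simp add: vec_eq_iff)
qed

section \<open>Spectral form of the relative entropy and data processing\<close>

lemma rel_entropy_relmod:
  assumes U: "unitary U" "\<forall>i. 0 < s i" and W: "unitary W" "\<forall>j. 0 < r j"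
  shows "rel_entropy (W ** diag r ** adj W) (U ** diag s ** adj U) =
    complex_of_real (- (\<Sum>(i, j)\<in>UNIV. (r j * (cmod ((adj U ** W) $ i $ j))\<^sup>2) * ln (s i / r j)))"
proof -
  have "rel_entropy (W ** diag r ** adj W) (U ** diag s ** adj U) =
      - trace (W ** diag r ** adj W ** relmod ln U s W r)"
    by (simp add: rel_entropy_def relmod_ln[OF U W] matrix_diff_ldistrib trace_sub)
  then show ?thesis
    unfolding trace_relmod[OF W(1)] by simp
qed

text \<open>Entropies are complex by type; this turns two inequalities between real parts into an
  equality.\<close>

lemma rel_entropy_real:
  assumes "pos_def \<rho>" "pos_def \<sigma>"
  shows "rel_entropy \<rho> \<sigma> = complex_of_real (Re (rel_entropy \<rho> \<sigma>))"
proof -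
  obtain U s where U: "unitary U" "\<forall>i. 0 < s i" "\<sigma> = U ** diag s ** adj U"
    using pos_def_diagonalization[OF assms(2)] .
  obtain W r where W: "unitary W" "\<forall>i. 0 < r i" "\<rho> = W ** diag r ** adj W"
    using pos_def_diagonalization[OF assms(1)] .
  show ?thesis
    unfolding U(3) W(3) rel_entropy_relmod[OF U(1,2) W(1,2)] by simp
qed

text \<open>Both entropies are minus logarithmic sums, with weights \<open>p\<close>,
  \<open>q\<close> at the ratios \<open>l\<close>, \<open>m\<close>. The gap between the simple
  fractions is a nonnegative form at \<open>x t - y t\<close>, and equal entropies make it vanish
  for every positive \<open>t\<close>.\<close>

theorem data_processing:
  assumes N: "vn_algebra N" and pd: "pos_def \<rho>" "pos_def \<sigma>"
  defines "\<rho>' \<equiv> trace_expectation N \<rho>" and "\<sigma>' \<equiv> trace_expectation N \<sigma>"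
  shows data_processing_inequality: "Re (rel_entropy \<rho>' \<sigma>') \<le> Re (rel_entropy \<rho> \<sigma>)"
    and data_processing_equality: "Re (rel_entropy \<rho>' \<sigma>') = Re (rel_entropy \<rho> \<sigma>) \<Longrightarrow>
      mat_powr \<sigma> a ** mat_powr \<rho> (- a) = mat_powr \<sigma>' a ** mat_powr \<rho>' (- a)"
proof -
  have pd': "pos_def \<rho>'" "pos_def \<sigma>'"
    using pd by (simp_all add: pos_def_trace_expectation[OF N] \<rho>'_def \<sigma>'_def)
  obtain U s where U: "unitary U" "\<forall>i. 0 < s i" "\<sigma> = U ** diag s ** adj U"
    using pos_def_diagonalization[OF pd(2)] .
  obtain W r where W: "unitary W" "\<forall>i. 0 < r i" "\<rho> = W ** diag r ** adj W"
    using pos_def_diagonalization[OF pd(1)] .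
  obtain U' s' where U': "unitary U'" "\<forall>i. 0 < s' i" "\<sigma>' = U' ** diag s' ** adj U'"
    using pos_def_diagonalization[OF pd'(2)] .
  obtain W' r' where W': "unitary W'" "\<forall>i. 0 < r' i" "\<rho>' = W' ** diag r' ** adj W'"
    using pos_def_diagonalization[OF pd'(1)] .
  define x where "x t = relmod (\<lambda>x. 1 / (t + x)) U s W r" for t
  define y where "y t = relmod (\<lambda>x. 1 / (t + x)) U' s' W' r'" for t
  define p where "p = (\<lambda>(i, j). r j * (cmod ((adj U ** W) $ i $ j))\<^sup>2)"
  define q where "q = (\<lambda>(i, j). r' j * (cmod ((adj U' ** W') $ i $ j))\<^sup>2)"
  define l where "l = (\<lambda>(i, j). s i / r j)"
  define m where "m = (\<lambda>(i, j). s' i / r' j)"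
  have tr: "trace (\<rho> ** relmod f U s W r) = of_real (\<Sum>k\<in>UNIV. p k * f (l k))" for f
    unfolding W(3) trace_relmod[OF W(1)] by (simp add: p_def l_def case_prod_beta)
  have tr': "trace (\<rho>' ** relmod f U' s' W' r') = of_real (\<Sum>k\<in>UNIV. q k * f (m k))" for f
    unfolding W'(3) trace_relmod[OF W'(1)] by (simp add: q_def m_def case_prod_beta)
  have ent: "Re (rel_entropy \<rho> \<sigma>) = - (\<Sum>k\<in>UNIV. p k * ln (l k))"
    unfolding U(3) W(3) rel_entropy_relmod[OF U(1,2) W(1,2)] by (simp add: p_def l_def case_prod_beta)
  have ent': "Re (rel_entropy \<rho>' \<sigma>') = - (\<Sum>k\<in>UNIV. q k * ln (m k))"
    unfolding U'(3) W'(3) rel_entropy_relmod[OF U'(1,2) W'(1,2)] by (simp add: q_def m_def case_prod_beta)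
  have x: "resolvent_eq t \<sigma> \<rho> (x t)" if "0 \<le> t" for t
    unfolding x_def U(3) W(3) using U W that by (intro resolvent_eq_relmod)
  have y: "resolvent_eq t \<sigma>' \<rho>' (y t)" if "0 \<le> t" for t
    unfolding y_def U'(3) W'(3) using U' W' that by (intro resolvent_eq_relmod)
  have gap: "(\<Sum>k\<in>UNIV. p k / (t + l k)) - (\<Sum>k\<in>UNIV. q k / (t + m k)) =
      Re (trace (adj (x t - y t) ** (t *\<^sub>R ((x t - y t) ** \<rho>) + \<sigma> ** (x t - y t))))" if t: "0 \<le> t" for t
    using resolvent_gap[OF N pd(2,1) t x[OF t] y[OF t, unfolded \<rho>'_def \<sigma>'_def]]
      tr[of "\<lambda>x. 1 / (t + x)"] tr'[of "\<lambda>x. 1 / (t + x)"]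
    unfolding x_def y_def by (simp flip: \<rho>'_def)
  \<comment> \<open>For the constant function 1 the weighted sums are traces, which the expectation
    preserves.\<close>
  have total: "sum p UNIV = sum q UNIV"
  proof -
    have "complex_of_real (sum p UNIV) = trace \<rho>" "complex_of_real (sum q UNIV) = trace \<rho>'"
      using tr[of "\<lambda>x. 1"] tr'[of "\<lambda>x. 1"] by (simp_all add: relmod_const U W U' W')
    moreover have "trace \<rho>' = trace \<rho>"
      by (simp add: \<rho>'_def trace_of_trace_expectation[OF N])
    ultimately show ?thesis
      by (metis of_real_eq_iff)
  qed
  have pos: "0 < l k" "0 < m k" for k
    using U W U' W' by (simp_all add: l_def m_def case_prod_beta)
  have frac: "(\<Sum>k\<in>UNIV. q k / (t + m k)) \<le> (\<Sum>k\<in>UNIV. p k / (t + l k))" if t: "0 \<le> t" for t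
    using gap[OF t] resolvent_zero(1)[OF pd(2,1) t, of "x t - y t"] by simp
  show "Re (rel_entropy \<rho>' \<sigma>') \<le> Re (rel_entropy \<rho> \<sigma>)"
    unfolding ent ent' using log_sum_le[OF total pos frac] by simp
  assume eq: "Re (rel_entropy \<rho>' \<sigma>') = Re (rel_entropy \<rho> \<sigma>)"
  have "x t = y t" if t: "0 < t" for t
  proof -
    have "(\<Sum>k\<in>UNIV. q k / (t + m k)) = (\<Sum>k\<in>UNIV. p k / (t + l k))"
      using eq unfolding ent ent' by (intro log_sum_eq[OF total pos frac _ t]) simp_all
    then have "x t - y t = 0"
      using t gap[of t] by (intro resolvent_zero(2)[OF pd(2,1), of t]) simp_all
    then show ?thesis
      by simp
  qed
  then have "relmod (\<lambda>x. x powr a) U s W r = relmod (\<lambda>x. x powr a) U' s' W' r'"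
    unfolding x_def y_def by (rule relmod_eqI[OF U(2) W(2) U'(2) W'(2)])
  then show "mat_powr \<sigma> a ** mat_powr \<rho> (- a) = mat_powr \<sigma>' a ** mat_powr \<rho>' (- a)"
    unfolding relmod_powr[OF U(1,2) W(1,2)] relmod_powr[OF U'(1,2) W'(1,2)]
    by (simp add: U(3) W(3) U'(3) W'(3))
qed

text \<open>A solution \<open>y\<close> of the resolvent equation for \<open>\<sigma>, \<rho>\<close> lies in \<open>C\<close>, hence commutes with \<open>k\<close> and
  also solves the equation for \<open>\<sigma> k, \<rho> k\<close>.\<close>

lemma mat_log_diff_commuting_factor:
  assumes C: "vn_algebra C" and mem: "\<sigma> \<in> C" "\<rho> \<in> C" and pd: "pos_def \<sigma>" "pos_def \<rho>"
    and k: "\<And>Z. Z \<in> C \<Longrightarrow> Z ** k = k ** Z" and pdk: "pos_def (\<sigma> ** k)" "pos_def (\<rho> ** k)"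
  shows "mat_log (\<sigma> ** k) - mat_log (\<rho> ** k) = mat_log \<sigma> - mat_log \<rho>"
proof -
  obtain U s where U: "unitary U" "\<forall>i. 0 < s i" "\<sigma> ** k = U ** diag s ** adj U"
    using pos_def_diagonalization[OF pdk(1)] .
  obtain W r where W: "unitary W" "\<forall>i. 0 < r i" "\<rho> ** k = W ** diag r ** adj W"
    using pos_def_diagonalization[OF pdk(2)] .
  obtain U' s' where U': "unitary U'" "\<forall>i. 0 < s' i" "\<sigma> = U' ** diag s' ** adj U'"
    using pos_def_diagonalization[OF pd(1)] .
  obtain W' r' where W': "unitary W'" "\<forall>i. 0 < r' i" "\<rho> = W' ** diag r' ** adj W'"
    using pos_def_diagonalization[OF pd(2)] .
  have "relmod (\<lambda>x. 1 / (t + x)) U s W r = relmod (\<lambda>x. 1 / (t + x)) U' s' W' r'" if "0 < t" for t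
  proof -
    let ?y = "relmod (\<lambda>x. 1 / (t + x)) U' s' W' r'"
    have t: "0 \<le> t"
      using that by simp
    have y: "resolvent_eq t \<sigma> \<rho> ?y"
      unfolding U'(3) W'(3) by (rule resolvent_eq_relmod[OF U'(1,2) W'(1,2) t])
    have yC: "?y \<in> C"
      by (rule resolvent_eq_mem[OF C pd mem t y])
    have "(t *\<^sub>R (?y ** \<rho>) + \<sigma> ** ?y) ** k = \<rho> ** k"
      using y by (simp add: resolvent_eq_def)
    moreover have "\<sigma> ** ?y ** k = \<sigma> ** k ** ?y"
      using k[OF yC] by (simp flip: matrix_mul_assoc)
    ultimately have "resolvent_eq t (\<sigma> ** k) (\<rho> ** k) ?y"
      by (simp add: resolvent_eq_def complex_matrix_add_rdistrib matrix_mult_scaleR matrix_mul_assoc)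
    moreover have "resolvent_eq t (\<sigma> ** k) (\<rho> ** k) (relmod (\<lambda>x. 1 / (t + x)) U s W r)"
      unfolding U(3) W(3) by (rule resolvent_eq_relmod[OF U(1,2) W(1,2) t])
    ultimately show ?thesis
      by (intro resolvent_eq_unique[OF pdk t])
  qed
  then have "relmod ln U s W r = relmod ln U' s' W' r'"
    by (rule relmod_eqI[OF U(2) W(2) U'(2) W'(2)])
  then show ?thesis
    unfolding relmod_ln[OF U(1,2) W(1,2)] relmod_ln[OF U'(1,2) W'(1,2)]
    by (simp flip: U(3) W(3) U'(3) W'(3))
qed

section \<open>Conditional expectations and modular invariance\<close>

lemma gns_separating:
  assumes "pos_def \<rho>" "gns_inner \<rho> X X = 0"
  shows "X = 0"
proof -
  have "trace (adj (adj X) ** \<rho> ** adj X) = 0"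
    using assms(2) trace_rotate[of X \<rho> "adj X"] trace_rotate[of "adj X" X \<rho>]
    by (simp add: gns_inner_def)
  then have "adj X = 0"
    by (rule trace_congruence_eq_0[OF assms(1)])
  then have "adj (adj X) = adj 0"
    by simp
  then show ?thesis
    using adj_mat[of 0] by simp
qed

text \<open>The GNS product is Tr(Z* X \<rho>), so test matrices from \<open>C\<close> see only the
  expectation of \<open>X ** \<rho>\<close>; dividing by that of \<rho> on the right solves the
  orthogonality equation.\<close>

lemma cond_expectation_eq:
  assumes C: "vn_algebra C" and pd: "pos_def \<rho>"
  shows "cond_expectation C \<rho> X =
    trace_expectation C (X ** \<rho>) ** mat_powr (trace_expectation C \<rho>) (- 1)"
    (is "_ = ?Y")
proof -
  note pdC = pos_def_trace_expectation[OF C pd]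
  have Y: "?Y \<in> C"
    by (intro vn_algebraD(3)[OF C] mat_powr_mem[OF C _ pdC] trace_expectation_mem[OF C])
  have orth: "gns_inner \<rho> Z (X - ?Y) = 0" if Z: "Z \<in> C" for Z
  proof -
    have Z': "adj Z \<in> C"
      using Z vn_algebraD(6)[OF C] by blast
    have "gns_inner \<rho> Z (X - ?Y) = trace (adj Z ** (X ** \<rho>)) - trace (adj Z ** ?Y ** \<rho>)"
      using trace_rotate[of "adj Z" X \<rho>] trace_rotate[of "adj Z" ?Y \<rho>]
      by (simp add: gns_inner_def matrix_diff_ldistrib trace_sub matrix_mul_assoc)
    also have "trace (adj Z ** ?Y ** \<rho>) = trace (adj Z ** ?Y ** trace_expectation C \<rho>)"
      using vn_algebraD(3)[OF C Z' Y] by (simp add: trace_trace_expectation[OF C])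
    also have "\<dots> = trace (adj Z ** trace_expectation C (X ** \<rho>))"
      by (simp add: matrix_mul_assoc mat_powr_minus_1[OF pdC])
    finally show ?thesis
      by (simp add: trace_trace_expectation[OF C Z'])
  qed
  show ?thesis
    unfolding cond_expectation_def orth_proj_def
  proof (rule the_equality)
    show "?Y \<in> C \<and> (\<forall>Z\<in>C. gns_inner \<rho> Z (X - ?Y) = 0)"
      using Y orth by blast
  next
    fix Y' assume Y': "Y' \<in> C \<and> (\<forall>Z\<in>C. gns_inner \<rho> Z (X - Y') = 0)"
    have D: "Y' - ?Y \<in> C"
      using Y Y' by (intro vn_algebra_diff[OF C]) auto
    have "gns_inner \<rho> (Y' - ?Y) (Y' - ?Y) = gns_inner \<rho> (Y' - ?Y) (X - ?Y) - gns_inner \<rho> (Y' - ?Y) (X - Y')"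
      by (simp add: gns_inner_def matrix_diff_ldistrib trace_sub)
    also have "\<dots> = 0"
      using orth[OF D] Y' D by simp
    finally have "Y' - ?Y = 0"
      by (rule gns_separating[OF pd])
    then show "Y' = ?Y"
      by simp
  qed
qed

text \<open>Cyclicity of the trace moves the factors of the closed form of
  \<open>cond_expectation\<close> onto \<sigma>. Self-adjointness of \<sigma>, inherited by its
  expectation, takes care of the adjoint in \<open>hs_inner\<close>.\<close>

lemma hs_adjoint_cond_expectation:
  assumes M: "vn_algebra M" and C: "vn_algebra C" "C \<subseteq> M"
    and \<rho>: "pos_def \<rho>" "\<rho> \<in> M" and \<sigma>: "adj \<sigma> = \<sigma>"
  shows "hs_adjoint M (cond_expectation C \<rho>) \<sigma> =
    trace_expectation C \<sigma> ** mat_powr (trace_expectation C \<rho>) (- 1) ** \<rho>"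
    (is "_ = ?W")
proof -
  let ?E = "trace_expectation C"
  let ?r = "mat_powr (?E \<rho>) (- 1)"
  note pdC = pos_def_trace_expectation[OF C(1) \<rho>(1)]
  have r: "?r \<in> C" "adj ?r = ?r"
    using pdC pos_def_mat_powr[OF pdC] by (simp_all add: mat_powr_mem[OF C(1)] trace_expectation_mem[OF C(1)])
  have E\<sigma>: "adj (?E \<sigma>) = ?E \<sigma>"
    using \<sigma> by (simp flip: trace_expectation_adj[OF C(1)])
  have W: "?W \<in> M"
    using r(1) C(2) \<rho>(2) trace_expectation_mem[OF C(1), of \<sigma>] by (intro vn_algebraD(3)[OF M]) auto
  have adjoint: "hs_inner ?W X = hs_inner \<sigma> (cond_expectation C \<rho> X)" for X
  proof -
    have "hs_inner \<sigma> (cond_expectation C \<rho> X) = trace (\<sigma> ** (?E (X ** \<rho>) ** ?r))"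
      by (simp add: hs_inner_def \<sigma> cond_expectation_eq[OF C(1) \<rho>(1)])
    also have "\<dots> = trace (?E \<sigma> ** (?E (X ** \<rho>) ** ?r))"
      using r(1) by (simp add: trace_trace_expectation'[OF C(1)] vn_algebraD(3)[OF C(1)] trace_expectation_mem[OF C(1)])
    also have "\<dots> = trace ((?r ** ?E \<sigma>) ** ?E (X ** \<rho>))"
      using trace_rotate[of "?E \<sigma>" "?E (X ** \<rho>)" ?r] by (simp add: matrix_mul_assoc)
    also have "\<dots> = trace ((?r ** ?E \<sigma>) ** (X ** \<rho>))"
      using r(1) by (intro trace_trace_expectation[OF C(1)] vn_algebraD(3)[OF C(1)] trace_expectation_mem[OF C(1)])
    also have "\<dots> = trace (adj ?W ** X)"
      using trace_rotate[of "?r ** ?E \<sigma>" X \<rho>] \<rho>(1) by (simp add: adj_mult r(2) E\<sigma> matrix_mul_assoc)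
    finally show ?thesis
      by (simp add: hs_inner_def)
  qed
  show ?thesis
    unfolding hs_adjoint_def
  proof (rule the_equality)
    show "?W \<in> M \<and> (\<forall>X\<in>M. hs_inner ?W X = hs_inner \<sigma> (cond_expectation C \<rho> X))"
      using W adjoint by blast
  next
    fix W' assume W': "W' \<in> M \<and> (\<forall>X\<in>M. hs_inner W' X = hs_inner \<sigma> (cond_expectation C \<rho> X))"
    then have "hs_inner W' (W' - ?W) = hs_inner ?W (W' - ?W)"
      using W adjoint vn_algebra_diff[OF M] by simp
    then have "trace (adj (W' - ?W) ** (W' - ?W)) = 0"
      by (simp only: hs_inner_def adj_diff matrix_diff_rdistrib trace_sub diff_self)
    then show "W' = ?W"
      using trace_adj_self_eq_0[of "W' - ?W"] by simp
  qed
qed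

text \<open>Invariance under the map taking X to \<rho>^{-1} X \<rho>, phrased without the
  inverse.\<close>

locale modular_invariant =
  fixes C :: "(complex^'n^'n) set" and \<rho> :: "complex^'n^'n"
  assumes C: "vn_algebra C" and pd: "pos_def \<rho>"
    and invariant: "X \<in> C \<Longrightarrow> \<exists>Y\<in>C. X ** \<rho> = \<rho> ** Y"
begin

abbreviation "\<rho>\<^sub>C \<equiv> trace_expectation C \<rho>"
abbreviation "r \<equiv> mat_powr \<rho>\<^sub>C (- 1)"

lemma pdC: "pos_def \<rho>\<^sub>C"
  by (rule pos_def_trace_expectation[OF C pd])

lemma mat_powr_mem_C: "mat_powr \<rho>\<^sub>C a \<in> C"
  by (intro mat_powr_mem[OF C _ pdC] trace_expectation_mem[OF C])

text \<open>Taking expectations in \<open>X ** \<rho> = \<rho> ** Y\<close> gives the same relation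
  with \<open>\<rho>\<^sub>C\<close>, which determines \<open>Y\<close>. Hence \<rho> and
  \<open>\<rho>\<^sub>C\<close> act alike on \<open>C\<close>.\<close>

lemma intertwine:
  assumes "X \<in> C"
  shows "X ** \<rho> = \<rho> ** r ** X ** \<rho>\<^sub>C"
proof -
  obtain Y where Y: "Y \<in> C" "X ** \<rho> = \<rho> ** Y"
    using invariant[OF assms] by blast
  have "X ** \<rho>\<^sub>C = trace_expectation C (X ** \<rho>)"
    by (simp add: trace_expectation_left[OF C assms])
  also have "\<dots> = \<rho>\<^sub>C ** Y"
    by (simp add: Y(2) trace_expectation_right[OF C Y(1)])
  finally have "r ** (X ** \<rho>\<^sub>C) = Y"
    by (simp add: matrix_mul_assoc mat_powr_minus_1[OF pdC])
  then show ?thesis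
    using Y(2) by (simp flip: matrix_mul_assoc)
qed

lemma \<rho>_commute: "\<rho>\<^sub>C ** \<rho> = \<rho> ** \<rho>\<^sub>C" "r ** \<rho> = \<rho> ** r"
proof -
  show *: "\<rho>\<^sub>C ** \<rho> = \<rho> ** \<rho>\<^sub>C"
    using intertwine[OF trace_expectation_mem[OF C]] by (simp add: mat_powr_minus_1[OF pdC])
  have "r ** (\<rho>\<^sub>C ** \<rho>) ** r = r ** (\<rho> ** \<rho>\<^sub>C) ** r"
    using * by simp
  then show "r ** \<rho> = \<rho> ** r"
    by (simp add: matrix_mul_assoc mat_powr_minus_1[OF pdC])
qed

text \<open>Intertwining is applied to \<open>Z ** r\<close>, where the trailing
  \<open>\<rho>\<^sub>C\<close> cancels. This makes \<open>r ** \<rho>\<close> the common factor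
  that can be removed from relative entropies.\<close>

lemma quotient_commute:
  assumes "Z \<in> C"
  shows "Z ** (r ** \<rho>) = r ** \<rho> ** Z"
  using intertwine[OF vn_algebraD(3)[OF C assms mat_powr_mem_C[of "- 1"]]]
  by (simp add: matrix_mul_assoc mat_powr_minus_1[OF pdC] flip: \<rho>_commute(2))

text \<open>With \<open>?h\<close> the root of \<sigma> and \<open>?g\<close> the root of
  \<open>r\<close>, commutation of \<open>C\<close> with \<open>r ** \<rho>\<close> rewrites the
  product as the congruence of \<rho> by \<open>?g ** ?h\<close>.\<close>

lemma pos_def_recovered:
  assumes "pos_def \<sigma>" "\<sigma> \<in> C"
  shows "pos_def (\<sigma> ** (r ** \<rho>))"
proof -
  let ?h = "mat_powr \<sigma> (1 / 2)" and ?g = "mat_powr \<rho>\<^sub>C (- (1 / 2))"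
  have h: "?h \<in> C" "pos_def ?h" and g: "?g \<in> C" "pos_def ?g"
    using assms pdC by (simp_all add: mat_powr_mem[OF C] mat_powr_mem_C pos_def_mat_powr)
  have gg: "?g ** ?g = r" "X ** ?g ** ?g = X ** r" for X
    using pdC by (simp_all add: mat_powr_add flip: matrix_mul_assoc)
  have "?g ** (r ** \<rho>) = r ** \<rho> ** ?g"
    by (rule quotient_commute[OF g(1)])
  moreover have "?g ** r = r ** ?g"
    using pdC by (simp add: mat_powr_add)
  ultimately have "r ** (?g ** \<rho>) = r ** (\<rho> ** ?g)"
    by (simp add: matrix_mul_assoc)
  then have "\<rho>\<^sub>C ** (r ** (?g ** \<rho>)) = \<rho>\<^sub>C ** (r ** (\<rho> ** ?g))"
    by simp
  then have g\<rho>: "?g ** \<rho> = \<rho> ** ?g"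
    by (simp add: matrix_mul_assoc mat_powr_minus_1[OF pdC])
  have "r ** \<rho> = ?g ** (?g ** \<rho>)"
    by (simp add: matrix_mul_assoc gg(1))
  also have "\<dots> = ?g ** (\<rho> ** ?g)"
    by (simp only: g\<rho>)
  also have "\<dots> = ?g ** \<rho> ** ?g"
    by (rule matrix_mul_assoc)
  finally have r\<rho>: "r ** \<rho> = ?g ** \<rho> ** ?g" .
  have "\<sigma> ** (r ** \<rho>) = ?h ** (?h ** (r ** \<rho>))"
    using assms(1) by (simp add: matrix_mul_assoc mat_powr_half)
  also have "\<dots> = ?h ** (r ** \<rho> ** ?h)"
    by (simp add: quotient_commute[OF h(1)])
  also have "\<dots> = ?h ** (?g ** \<rho> ** ?g ** ?h)"
    by (simp only: r\<rho>)
  also have "\<dots> = adj (?g ** ?h) ** \<rho> ** (?g ** ?h)"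
    using h(2) g(2) by (simp add: adj_mult matrix_mul_assoc)
  finally show ?thesis
    using pos_def_congruence[OF pd invertible_mult[OF invertible_pos_def[OF g(2)] invertible_pos_def[OF h(2)]]]
    by simp
qed

text \<open>As \<rho> is \<open>\<rho>\<^sub>C ** (r ** \<rho>)\<close>, the common factor drops out
  of the difference of logarithms. That difference then lies in \<open>C\<close>, so the trace sees
  only \<open>\<rho>\<^sub>C\<close>.\<close>

lemma rel_entropy_recovered:
  assumes "pos_def \<sigma>" "\<sigma> \<in> C"
  shows "rel_entropy \<rho> (\<sigma> ** (r ** \<rho>)) = rel_entropy \<rho>\<^sub>C \<sigma>"
proof -
  have \<rho>: "\<rho>\<^sub>C ** (r ** \<rho>) = \<rho>"
    by (simp add: matrix_mul_assoc mat_powr_minus_1[OF pdC])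
  have "mat_log (\<sigma> ** (r ** \<rho>)) - mat_log (\<rho>\<^sub>C ** (r ** \<rho>)) = mat_log \<sigma> - mat_log \<rho>\<^sub>C"
    using pos_def_recovered[OF assms] pd
    by (intro mat_log_diff_commuting_factor[OF C assms(2) trace_expectation_mem[OF C] assms(1) pdC quotient_commute])
      (simp_all add: \<rho>)
  then have "mat_log \<rho> - mat_log (\<sigma> ** (r ** \<rho>)) = mat_log \<rho>\<^sub>C - mat_log \<sigma>"
    by (simp add: \<rho> algebra_simps)
  moreover have "mat_log \<rho>\<^sub>C - mat_log \<sigma> \<in> C"
    using assms pdC unfolding mat_log_def
    by (intro vn_algebra_diff[OF C] fun_calc_mem[OF C]) (simp_all add: trace_expectation_mem[OF C])
  ultimately show ?thesis
    by (simp add: rel_entropy_def trace_trace_expectation'[OF C])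
qed

end

section \<open>The fixed points of the coarse graining operator\<close>

locale coarse_graining =
  fixes M N :: "(complex^'n^'n) set" and \<rho> :: "complex^'n^'n"
  assumes N: "vn_algebra N" "N \<subseteq> M" and pd: "pos_def \<rho>"
begin

abbreviation "E \<equiv> trace_expectation N"
abbreviation "C \<equiv> ac_fixed_points M N \<rho>"
definition "h = mat_powr \<rho> (1 / 2)"
definition "H = mat_powr (E \<rho>) (1 / 2)"
definition "G = mat_powr (E \<rho>) (- 1 / 2)"

lemma pdN: "pos_def (E \<rho>)"
  by (rule pos_def_trace_expectation[OF N(1) pd])

lemma roots_mem: "H \<in> N" "G \<in> N"
  by (simp_all add: H_def G_def mat_powr_mem[OF N(1)] trace_expectation_mem[OF N(1)] pdN)

lemma roots_adj [simp]: "adj h = h" "adj H = H" "adj G = G"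
  using pd pdN by (simp_all add: h_def H_def G_def pos_def_mat_powr)

text \<open>The variants with a left factor \<open>X\<close> serve products associated to the left,
  where a cancelling pair is not a subterm.\<close>

lemma roots_mult [simp]:
  "h ** h = \<rho>" "H ** H = E \<rho>" "H ** G = mat 1" "G ** H = mat 1"
  "X ** h ** h = X ** \<rho>" "X ** H ** H = X ** E \<rho>" "X ** H ** G = X" "X ** G ** H = X"
  "E \<rho> ** G = H" "G ** E \<rho> = H" "X ** E \<rho> ** G = X ** H" "X ** G ** E \<rho> = X ** H"
proof -
  have "E \<rho> ** G = mat_powr (E \<rho>) 1 ** G" "G ** E \<rho> = G ** mat_powr (E \<rho>) 1"
    by (simp_all add: mat_powr_1[OF pdN])
  then show "E \<rho> ** G = H" "G ** E \<rho> = H"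
    by (simp_all add: G_def H_def mat_powr_add[OF pdN])
  then show "X ** E \<rho> ** G = X ** H" "X ** G ** E \<rho> = X ** H"
    by (simp_all flip: matrix_mul_assoc)
qed (use pd pdN in \<open>simp_all add: h_def H_def G_def mat_powr_half mat_powr_cancel\<close>)

text \<open>Conjugation by \<open>H\<close> undoes conjugation by \<open>G\<close>, and a fixed
  point lies in \<open>N\<close> because the operator takes its values there.\<close>

lemma fixed_iff: "X \<in> C \<longleftrightarrow> X \<in> N \<and> E (h ** X ** h) = H ** X ** H"
proof -
  have A: "accardi_cecchini N \<rho> X = G ** E (h ** X ** h) ** G"
    by (simp add: accardi_cecchini_def Let_def G_def h_def)
  show ?thesis
  proof
    assume "X \<in> C"
    then have X: "X = G ** E (h ** X ** h) ** G"
      using A by (simp add: ac_fixed_points_def)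
    then have "H ** X ** H = H ** (G ** E (h ** X ** h) ** G) ** H"
      by simp
    then have "H ** X ** H = E (h ** X ** h)"
      by (simp add: matrix_mul_assoc)
    moreover have "X \<in> N"
      by (subst X) (intro vn_algebraD(3)[OF N(1)] roots_mem trace_expectation_mem[OF N(1)])
    ultimately show "X \<in> N \<and> E (h ** X ** h) = H ** X ** H"
      by simp
  next
    assume "X \<in> N \<and> E (h ** X ** h) = H ** X ** H"
    then show "X \<in> C"
      using N(2) by (auto simp: ac_fixed_points_def A matrix_mul_assoc)
  qed
qed

lemma fixed_adj:
  assumes "X \<in> C"
  shows "adj X \<in> C"
proof -
  have X: "X \<in> N" "E (h ** X ** h) = H ** X ** H"
    using assms fixed_iff by auto
  have "E (h ** adj X ** h) = E (adj (h ** X ** h))"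
    by (simp add: adj_mult matrix_mul_assoc)
  also have "\<dots> = H ** adj X ** H"
    unfolding trace_expectation_adj[OF N(1)] X(2) by (simp add: adj_mult matrix_mul_assoc)
  finally show ?thesis
    using vn_algebraD(6)[OF N(1) X(1)] fixed_iff by blast
qed

text \<open>Expanding the squared Hilbert-Schmidt norm of the difference of the two sides, all four terms
  equal \<open>Tr (X\<^sup>* X \<rho>\<^sub>N)\<close>.\<close>

lemma fixed_right:
  assumes "X \<in> C"
  shows "X ** h = h ** G ** X ** H"
proof -
  have X: "X \<in> N" "E (h ** X ** h) = H ** X ** H" and X': "adj X \<in> N" "E (h ** adj X ** h) = H ** adj X ** H"
    using assms fixed_adj[OF assms] fixed_iff by auto
  let ?T = "trace (H ** adj X ** X ** H)"
  have T: "?T = trace (adj X ** X ** E \<rho>)"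
    using trace_rotate[of H "adj X ** X" H] trace_rotate[of "E \<rho>" "adj X" X] trace_mult_commute[of "E \<rho>" "adj X ** X"]
    by (simp add: matrix_mul_assoc)
  have 1: "trace (h ** adj X ** (X ** h)) = ?T"
  proof -
    have "trace (h ** adj X ** (X ** h)) = trace (adj X ** X ** \<rho>)"
      using trace_rotate[of h "adj X ** X" h] trace_mult_commute[of \<rho> "adj X ** X"]
      by (simp add: matrix_mul_assoc)
    then show ?thesis
      unfolding T using X X' by (simp add: trace_trace_expectation[OF N(1)] vn_algebraD(3)[OF N(1)])
  qed
  have Y: "G ** X ** H \<in> N" "H ** adj X ** G \<in> N"
    using X X' roots_mem by (simp_all add: vn_algebraD(3)[OF N(1)])
  \<comment> \<open>The factor \<open>G ** X ** H\<close> lies in \<open>N\<close>, so the rest may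
    be replaced by its expectation, known from the fixed-point equation for
    \<open>adj X\<close>.\<close>
  have 2: "trace (h ** adj X ** (h ** G ** X ** H)) = ?T"
  proof -
    have "trace (h ** adj X ** (h ** G ** X ** H)) = trace (E (h ** adj X ** h) ** (G ** X ** H))"
      unfolding trace_trace_expectation'[OF N(1) Y(1)] by (simp add: matrix_mul_assoc)
    then show ?thesis
      by (simp add: X'(2) matrix_mul_assoc)
  qed
  have 3: "trace (H ** adj X ** G ** h ** (X ** h)) = ?T"
  proof -
    have "trace (H ** adj X ** G ** h ** (X ** h)) = trace ((H ** adj X ** G) ** E (h ** X ** h))"
      by (simp add: trace_trace_expectation[OF N(1) Y(2)] matrix_mul_assoc)
    then show ?thesis
      by (simp add: X(2) matrix_mul_assoc)
  qed
  have 4: "trace (H ** adj X ** G ** h ** (h ** G ** X ** H)) = ?T"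
  proof -
    have "trace (H ** adj X ** G ** h ** (h ** G ** X ** H)) = trace (E ((H ** adj X ** G) ** \<rho> ** (G ** X ** H)))"
      by (simp add: trace_of_trace_expectation[OF N(1)] matrix_mul_assoc)
    then show ?thesis
      unfolding trace_expectation_right[OF N(1) Y(1)] trace_expectation_left[OF N(1) Y(2)]
      by (simp add: matrix_mul_assoc)
  qed
  let ?Z = "X ** h - h ** G ** X ** H"
  have "adj ?Z = h ** adj X - H ** adj X ** G ** h"
    by (simp add: adj_diff adj_mult matrix_mul_assoc)
  then have "trace (adj ?Z ** ?Z) = 0"
    by (simp only: matrix_diff_ldistrib matrix_diff_rdistrib trace_sub 1 2 3 4) simp
  then show ?thesis
    using trace_adj_self_eq_0[of ?Z] by simp
qed

text \<open>After left multiplication by \<open>h\<close>, the factor \<open>G ** X ** H\<close>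
  from \<open>N\<close> passes through \<open>E\<close>. Together with \<open>fixed_right\<close>,
  this describes \<open>C\<close> inside \<open>N\<close> by an intertwining relation.\<close>

lemma fixedI_right:
  assumes X: "X \<in> N" and eq: "X ** h = h ** G ** X ** H"
  shows "X \<in> C"
proof -
  have Y: "G ** X ** H \<in> N"
    using X roots_mem by (simp add: vn_algebraD(3)[OF N(1)])
  have "h ** X ** h = \<rho> ** (G ** X ** H)"
    unfolding matrix_mul_assoc[symmetric, of h] eq by (simp add: matrix_mul_assoc)
  then have "E (h ** X ** h) = E \<rho> ** (G ** X ** H)"
    by (simp add: trace_expectation_right[OF N(1) Y])
  then show ?thesis
    using X by (simp add: fixed_iff matrix_mul_assoc)
qed

lemma fixedI_left:
  assumes X: "X \<in> N" and eq: "h ** X = H ** X ** G ** h"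
  shows "X \<in> C"
proof -
  have "adj (h ** X) = adj (H ** X ** G ** h)"
    using eq by simp
  then have "adj X ** h = h ** G ** adj X ** H"
    by (simp add: adj_mult matrix_mul_assoc)
  then have "adj X \<in> C"
    using vn_algebraD(6)[OF N(1) X] by (intro fixedI_right)
  then show ?thesis
    using fixed_adj by fastforce
qed

lemma fixed_subset: "C \<subseteq> N"
  using fixed_iff by blast

text \<open>The relation \<open>X ** h = h ** G ** X ** H\<close> is linear in \<open>X\<close> and,
  as \<open>H ** G = mat 1\<close>, stable under products.\<close>

lemma vn_algebra_fixed: "vn_algebra C"
  unfolding vn_algebra_def
proof (intro conjI ballI allI)
  show "mat 1 \<in> C"
    by (rule fixedI_right) (simp_all add: vn_algebraD(1)[OF N(1)])
  fix X assume X: "X \<in> C"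
  then have XN: "X \<in> N"
    using fixed_subset by blast
  show "adj X \<in> C"
    using X by (rule fixed_adj)
  show "mat c ** X \<in> C" for c
  proof (rule fixedI_right)
    show "mat c ** X \<in> N"
      using XN by (rule vn_algebraD(4)[OF N(1)])
    show "mat c ** X ** h = h ** G ** (mat c ** X) ** H"
      using fixed_right[OF X] by (simp add: mat_mult_left_commute flip: matrix_mul_assoc)
  qed
  fix Y assume Y: "Y \<in> C"
  then have YN: "Y \<in> N"
    using fixed_subset by blast
  show "X + Y \<in> C"
  proof (rule fixedI_right)
    show "X + Y \<in> N"
      using XN YN by (rule vn_algebraD(2)[OF N(1)])
    show "(X + Y) ** h = h ** G ** (X + Y) ** H"
      using fixed_right[OF X] fixed_right[OF Y]
      by (simp add: complex_matrix_add_rdistrib matrix_add_ldistrib)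
  qed
  show "X ** Y \<in> C"
  proof (rule fixedI_right)
    show "X ** Y \<in> N"
      using XN YN by (rule vn_algebraD(3)[OF N(1)])
    have "X ** Y ** h = X ** (h ** G ** Y ** H)"
      using fixed_right[OF Y] by (simp flip: matrix_mul_assoc)
    also have "\<dots> = X ** h ** G ** Y ** H"
      by (simp add: matrix_mul_assoc)
    also have "\<dots> = h ** G ** (X ** Y) ** H"
      unfolding fixed_right[OF X] by (simp add: matrix_mul_assoc)
    finally show "X ** Y ** h = h ** G ** (X ** Y) ** H" .
  qed
qed

text \<open>By \<open>fixed_right\<close>, both sides of the left relation for
  \<open>G ** X ** H\<close> reduce to \<open>X ** h\<close>.\<close>

lemma fixed_modular:
  assumes "X \<in> C"
  shows "G ** X ** H \<in> C"
proof (rule fixedI_left)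
  show "G ** X ** H \<in> N"
    using assms fixed_subset roots_mem by (auto simp: vn_algebraD(3)[OF N(1)])
  show "h ** (G ** X ** H) = H ** (G ** X ** H) ** G ** h"
    using fixed_right[OF assms] by (simp add: matrix_mul_assoc)
qed

text \<open>Each factor \<open>h\<close> moved to the left of \<open>X\<close> costs one step from
  \<open>X\<close> to \<open>G ** X ** H\<close>; two such steps carry \<rho> across.\<close>

sublocale modular_invariant C \<rho>
proof
  show "vn_algebra C"
    by (rule vn_algebra_fixed)
  show "pos_def \<rho>"
    by (rule pd)
  fix X assume X: "X \<in> C"
  let ?Y = "G ** X ** H"
  have "X ** \<rho> = X ** h ** h"
    by simp
  also have "\<dots> = h ** (?Y ** h)"
    unfolding fixed_right[OF X] by (simp add: matrix_mul_assoc)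
  also have "\<dots> = \<rho> ** (G ** ?Y ** H)"
    unfolding fixed_right[OF fixed_modular[OF X]] by (simp add: matrix_mul_assoc)
  finally show "\<exists>Y\<in>C. X ** \<rho> = \<rho> ** Y"
    using fixed_modular[OF fixed_modular[OF X]] by blast
qed

text \<open>With \<open>u\<^sub>a = \<sigma>\<^sup>a \<rho>\<^sup>-\<^sup>a\<close>, the cocycle identity \<open>u\<^sub>3\<^sub>/\<^sub>2 = u\<^sub>1\<^sub>/\<^sub>2 \<rho>\<^sup>1\<^sup>/\<^sup>2 u\<^sub>1 \<rho>\<^sup>-\<^sup>1\<^sup>/\<^sup>2\<close> holds in \<open>M\<close> as well as in \<open>N\<close>,
  and equality in the data processing inequality identifies the cocycles of \<open>M\<close> and \<open>N\<close>.\<close>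

lemma density_fixed:
  assumes \<sigma>: "pos_def \<sigma>" and eq: "rel_entropy \<rho> \<sigma> = rel_entropy (E \<rho>) (E \<sigma>)"
  shows "\<sigma> ** mat_powr \<rho> (- 1) \<in> C"
proof (rule fixedI_left)
  let ?D = "\<sigma> ** mat_powr \<rho> (- 1)"
  have pd\<sigma>N: "pos_def (E \<sigma>)"
    by (rule pos_def_trace_expectation[OF N(1) \<sigma>])
  define u where "u a = mat_powr \<sigma> a ** mat_powr \<rho> (- a)" for a
  have u: "u a = mat_powr (E \<sigma>) a ** mat_powr (E \<rho>) (- a)" for a
    unfolding u_def using eq by (intro data_processing_equality[OF N(1) pd \<sigma>]) simp
  have D: "?D = u 1"
    using \<sigma> by (simp add: u_def mat_powr_1)
  show "?D \<in> N"
    unfolding D u using pdN pd\<sigma>N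
    by (intro vn_algebraD(3)[OF N(1)] mat_powr_mem[OF N(1)] trace_expectation_mem[OF N(1)])
  have cocycle: "mat_powr S (3 / 2) ** mat_powr R (- (3 / 2)) = mat_powr S (1 / 2) ** mat_powr R (- (1 / 2)) **
      (mat_powr R (1 / 2) ** (mat_powr S 1 ** mat_powr R (- 1)) ** mat_powr R (- (1 / 2)))"
    if "pos_def S" "pos_def R" for S R :: "complex^'n^'n"
  proof -
    have "mat_powr S (1 / 2) ** mat_powr R (- (1 / 2)) **
      (mat_powr R (1 / 2) ** (mat_powr S 1 ** mat_powr R (- 1)) ** mat_powr R (- (1 / 2))) =
      (mat_powr S (1 / 2) ** mat_powr S 1) ** (mat_powr R (- 1) ** mat_powr R (- (1 / 2)))"
      using that by (simp add: matrix_mul_assoc mat_powr_cancel)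
    then show ?thesis
      using that by (simp add: mat_powr_add)
  qed
  have "u (1 / 2) ** (h ** u 1 ** mat_powr \<rho> (- (1 / 2))) = u (3 / 2)"
    unfolding u_def h_def cocycle[OF \<sigma> pd] ..
  also have "\<dots> = u (1 / 2) ** (H ** u 1 ** G)"
    using cocycle[OF pd\<sigma>N pdN] by (simp add: u H_def G_def)
  \<comment> \<open>The prefixed product inverts \<open>u (1 / 2)\<close>, leaving the left relation
    that characterizes \<open>C\<close>.\<close>
  finally have "mat_powr \<rho> (1 / 2) ** mat_powr \<sigma> (- (1 / 2)) ** (u (1 / 2) ** (h ** u 1 ** mat_powr \<rho> (- (1 / 2)))) =
      mat_powr \<rho> (1 / 2) ** mat_powr \<sigma> (- (1 / 2)) ** (u (1 / 2) ** (H ** u 1 ** G))"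
    by simp
  moreover have "mat_powr \<rho> (1 / 2) ** mat_powr \<sigma> (- (1 / 2)) ** (u (1 / 2) ** X) = X"
    for X :: "complex^'n^'n"
    using pd \<sigma> by (simp add: u_def matrix_mul_assoc mat_powr_cancel)
  ultimately have "h ** u 1 ** mat_powr \<rho> (- (1 / 2)) = H ** u 1 ** G"
    by (simp only:)
  then have "h ** u 1 ** mat_powr \<rho> (- (1 / 2)) ** h = H ** u 1 ** G ** h"
    by simp
  then show "h ** ?D = H ** ?D ** G ** h"
    using pd unfolding D by (simp add: h_def mat_powr_cancel)
qed

end

section \<open>Equality of relative entropies through the fixed-point algebra\<close>

theorem corollary1p10:
  fixes M N C :: "(complex^'n^'n) set"
    and \<rho> \<sigma> \<rho>\<^sub>N \<sigma>\<^sub>N \<rho>\<^sub>C \<sigma>\<^sub>C :: "complex^'n^'n"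
  assumes "vn_algebra M"
    and "vn_algebra N" and "N \<subseteq> M"
    and "faithful_state M \<rho>" and "faithful_state M \<sigma>"
  defines "\<rho>\<^sub>N \<equiv> trace_expectation N \<rho>"
    and "\<sigma>\<^sub>N \<equiv> trace_expectation N \<sigma>"
    and "C \<equiv> ac_fixed_points M N \<rho>"
    and "\<rho>\<^sub>C \<equiv> hs_adjoint M (cond_expectation C \<rho>) \<rho>"
    and "\<sigma>\<^sub>C \<equiv> hs_adjoint M (cond_expectation C \<rho>) \<sigma>"
  shows "(rel_entropy \<rho> \<sigma> = rel_entropy \<rho>\<^sub>N \<sigma>\<^sub>N \<longleftrightarrow>
            rel_entropy \<rho> \<sigma> = rel_entropy \<rho>\<^sub>C \<sigma>\<^sub>C) \<and>
         (C = range mat \<longrightarrow>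
            (rel_entropy \<rho> \<sigma> = rel_entropy \<rho>\<^sub>N \<sigma>\<^sub>N \<longleftrightarrow> \<rho> = \<sigma>))"
proof -
  have pos: "pos_def \<rho>" "pos_def \<sigma>"
    by (simp_all add: faithful_state_pos_def[OF assms(4)] faithful_state_pos_def[OF assms(5)])
  interpret coarse_graining M N \<rho>
    using assms(2,3) pos(1) by unfold_locales
  let ?F = "trace_expectation C"
  let ?r = "mat_powr (?F \<rho>) (- 1)"
  let ?D = "\<sigma> ** mat_powr \<rho> (- 1)"
  have C_vn: "vn_algebra C" and CN: "C \<subseteq> N"
    unfolding C_def by (rule vn_algebra_fixed, rule fixed_subset)
  have pdF: "pos_def (?F \<rho>)" "pos_def (?F \<sigma>)" and pdN': "pos_def \<rho>\<^sub>N" "pos_def \<sigma>\<^sub>N"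
    using pos by (simp_all add: pos_def_trace_expectation C_vn assms(2) \<rho>\<^sub>N_def \<sigma>\<^sub>N_def)
  have "C \<subseteq> M" "\<rho> \<in> M"
    using CN assms(3,4) by (auto simp: faithful_state_def)
  then have adjoint: "hs_adjoint M (cond_expectation C \<rho>) \<tau> = ?F \<tau> ** ?r ** \<rho>" if "pos_def \<tau>" for \<tau>
    using that by (intro hs_adjoint_cond_expectation assms(1) C_vn pos(1)) simp_all
  have \<rho>\<^sub>C: "\<rho>\<^sub>C = \<rho>"
    unfolding \<rho>\<^sub>C_def adjoint[OF pos(1)] by (simp add: mat_powr_minus_1[OF pdF(1)])
  have \<sigma>\<^sub>C: "\<sigma>\<^sub>C = ?F \<sigma> ** ?r ** \<rho>"
    unfolding \<sigma>\<^sub>C_def adjoint[OF pos(2)] ..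
  have \<sigma>: "\<sigma> = ?D ** \<rho>"
    by (simp add: mat_powr_minus_1[OF pos(1)])
  have D_mem: "?D \<in> C" if "rel_entropy \<rho> \<sigma> = rel_entropy \<rho>\<^sub>N \<sigma>\<^sub>N"
    using that unfolding C_def \<rho>\<^sub>N_def \<sigma>\<^sub>N_def by (rule density_fixed[OF pos(2)])
  \<comment> \<open>If \<open>?D\<close> lies in \<open>C\<close>, it passes through
    \<open>?F\<close>, and the closed form of the adjoint returns
    \<open>?D ** \<rho>\<close>.\<close>
  have "\<sigma>\<^sub>C = \<sigma>" if D: "?D \<in> C"
  proof -
    have "?F \<sigma> = ?D ** ?F \<rho>"
      by (subst \<sigma>) (rule trace_expectation_left[OF C_vn D])
    then have "\<sigma>\<^sub>C = ?D ** \<rho>"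
      unfolding \<sigma>\<^sub>C by (simp add: mat_powr_minus_1[OF pdF(1)])
    then show ?thesis
      using \<sigma> by simp
  qed
  then have forward: "rel_entropy \<rho> \<sigma> = rel_entropy \<rho>\<^sub>C \<sigma>\<^sub>C" if "rel_entropy \<rho> \<sigma> = rel_entropy \<rho>\<^sub>N \<sigma>\<^sub>N"
    using D_mem[OF that] \<rho>\<^sub>C by simp
  have backward: "rel_entropy \<rho> \<sigma> = rel_entropy \<rho>\<^sub>N \<sigma>\<^sub>N" if eq: "rel_entropy \<rho> \<sigma> = rel_entropy \<rho>\<^sub>C \<sigma>\<^sub>C"
  proof -
    have "rel_entropy \<rho>\<^sub>C \<sigma>\<^sub>C = rel_entropy (?F \<rho>) (?F \<sigma>)"
      using rel_entropy_recovered[OF pdF(2)[unfolded C_def] trace_expectation_mem[OF vn_algebra_fixed]]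
      unfolding \<rho>\<^sub>C \<sigma>\<^sub>C C_def by (simp add: matrix_mul_assoc)
    \<comment> \<open>Factoring \<open>?F\<close> through \<open>N\<close> makes data processing
      from \<open>N\<close> to \<open>C\<close> bound this entropy by that of
      \<open>\<rho>\<^sub>N\<close> and \<open>\<sigma>\<^sub>N\<close>.\<close>
    also have "\<dots> = rel_entropy (?F \<rho>\<^sub>N) (?F \<sigma>\<^sub>N)"
      by (simp add: \<rho>\<^sub>N_def \<sigma>\<^sub>N_def trace_expectation_tower[OF assms(2) C_vn CN])
    finally have "Re (rel_entropy \<rho> \<sigma>) \<le> Re (rel_entropy \<rho>\<^sub>N \<sigma>\<^sub>N)"
      using data_processing_inequality[OF C_vn pdN'] eq by simp
    moreover have "Re (rel_entropy \<rho>\<^sub>N \<sigma>\<^sub>N) \<le> Re (rel_entropy \<rho> \<sigma>)"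
      unfolding \<rho>\<^sub>N_def \<sigma>\<^sub>N_def by (rule data_processing_inequality[OF assms(2) pos])
    ultimately show ?thesis
      using rel_entropy_real[OF pos] rel_entropy_real[OF pdN'] by simp
  qed
  have "\<rho> = \<sigma>" if scalars: "C = range mat" and eq: "rel_entropy \<rho> \<sigma> = rel_entropy \<rho>\<^sub>N \<sigma>\<^sub>N"
  proof -
    \<comment> \<open>The density is a scalar, and equality of the two traces forces it to be
      1.\<close>
    obtain c where "?D = mat c"
      using D_mem[OF eq] scalars by auto
    then have c: "\<sigma> = mat c ** \<rho>"
      using \<sigma> by simp
    have "trace \<sigma> = 1" "trace \<rho> = 1"
      using assms(4,5) by (simp_all add: faithful_state_def)
    then have "c = 1"
      unfolding c by (simp add: trace_mat_mult)
    then show ?thesis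
      using c by simp
  qed
  moreover have "rel_entropy \<rho> \<sigma> = rel_entropy \<rho>\<^sub>N \<sigma>\<^sub>N" if "\<rho> = \<sigma>"
    using that by (simp add: rel_entropy_def \<rho>\<^sub>N_def \<sigma>\<^sub>N_def)
  ultimately show ?thesis
    using forward backward by blast
qed

end
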